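(* Let $G$ be a finite group such that the derived subgroup $G'$ is cyclic, and let $T$ be a group of the form $C_{p^h}\rtimes C_{q^k}$ with $p$ and $q$ different primes. If $V(\mathbb{Z}G)$ has a subgroup isomorphic to $T$, then so does $G$.
   Context: $C_n$ denotes the cyclic group of order $n$; $h,k$ are positive integers, and the semidirect product may be taken with respect to any action (possibly trivial, and not necessarily faithful). $V(\mathbb{Z}G)$ denotes the group of units of augmentation $1$ in the integral group ring $\mathbb{Z}G$. *)

theory Defs
  imports "HOL-Algebra.Algebra" "HOL-Computational_Algebra.Primes"
begin

text \<open>
  As in \<^const>\<open>free_Abelian_group\<close>, a formal integer combination of elements of \<open>G\<close> is a finitely
  supported function with support in \<^term>\<open>carrier G\<close>; the basis element of \<open>g\<close> is \<^term>\<open>frag_of g\<close>.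
  The product is the biadditive extension of \<open>frag_of g \<cdot> frag_of h = frag_of (g \<otimes> h)\<close>.
\<close>

definition integral_group_ring :: "('a, 'b) monoid_scheme \<Rightarrow> ('a \<Rightarrow>\<^sub>0 int) ring"
  where "integral_group_ring G =
    \<lparr>carrier = {a. Poly_Mapping.keys a \<subseteq> carrier G},
     monoid.mult = (\<lambda>a b. frag_extend (\<lambda>g. frag_extend (\<lambda>h. frag_of (g \<otimes>\<^bsub>G\<^esub> h)) b) a),
     one = frag_of \<one>\<^bsub>G\<^esub>,
     ring.zero = 0,
     ring.add = (+)\<rparr>"

definition augmentation :: "('a \<Rightarrow>\<^sub>0 int) \<Rightarrow> int"
  where "augmentation a = (\<Sum>g\<in>Poly_Mapping.keys a. Poly_Mapping.lookup a g)"

definition normalized_units :: "('a, 'b) monoid_scheme \<Rightarrow> ('a \<Rightarrow>\<^sub>0 int) monoid"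
  where "normalized_units G = (units_of (integral_group_ring G))
    \<lparr>carrier := {u \<in> Units (integral_group_ring G). augmentation u = 1}\<rparr>"

text \<open>
  The (outer) semidirect product \<open>N \<rtimes> H\<close>, meaningful for an action
  \<open>\<phi> \<in> hom H (AutoGroup N)\<close>.
\<close>

definition semidirect_product ::
    "('a, 'c) monoid_scheme \<Rightarrow> ('b, 'd) monoid_scheme \<Rightarrow> ('b \<Rightarrow> 'a \<Rightarrow> 'a) \<Rightarrow> ('a \<times> 'b) monoid"
  where "semidirect_product N H \<phi> =
    \<lparr>carrier = carrier N \<times> carrier H,
     monoid.mult = (\<lambda>(n, h) (n', h'). (n \<otimes>\<^bsub>N\<^esub> \<phi> h n', h \<otimes>\<^bsub>H\<^esub> h')),
     one = (\<one>\<^bsub>N\<^esub>, \<one>\<^bsub>H\<^esub>)\<rparr>"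

lemma integral_group_ring_simps:
  "carrier (integral_group_ring G) = {a. Poly_Mapping.keys a \<subseteq> carrier G}"
  "a \<otimes>\<^bsub>integral_group_ring G\<^esub> b =
     frag_extend (\<lambda>g. frag_extend (\<lambda>h. frag_of (g \<otimes>\<^bsub>G\<^esub> h)) b) a"
  "\<one>\<^bsub>integral_group_ring G\<^esub> = frag_of \<one>\<^bsub>G\<^esub>"
  "\<zero>\<^bsub>integral_group_ring G\<^esub> = 0"
  "a \<oplus>\<^bsub>integral_group_ring G\<^esub> b = a + b"
  by (simp_all add: integral_group_ring_def)

lemma frag_extend_fun_diff:
  "frag_extend (\<lambda>x. f x - g x) c = frag_extend f c - frag_extend g c"
  using subset_UNIV by (induction c rule: frag_induction) (auto simp: frag_extend_diff)

lemma frag_extend_fun_add: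
  "frag_extend (\<lambda>x. f x + g x) c = frag_extend f c + frag_extend g c"
  using subset_UNIV by (induction c rule: frag_induction) (auto simp: frag_extend_diff)

lemma (in group) ring_integral_group_ring: "ring (integral_group_ring G)"
proof -
  let ?R = "integral_group_ring G"
  have ag: "abelian_group ?R"
  proof (rule abelian_groupI)
    fix x assume "x \<in> carrier ?R"
    then show "\<exists>y\<in>carrier ?R. y \<oplus>\<^bsub>?R\<^esub> x = \<zero>\<^bsub>?R\<^esub>"
      by (intro bexI[of _ "- x"]) (auto simp: integral_group_ring_simps)
  qed (use keys_add in \<open>fastforce simp: integral_group_ring_simps algebra_simps\<close>)+
  have closed: "a \<otimes>\<^bsub>?R\<^esub> b \<in> carrier ?R" if "a \<in> carrier ?R" "b \<in> carrier ?R" for a b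
    using that unfolding integral_group_ring_simps
    by (auto dest!: subsetD[OF keys_frag_extend] simp: subset_iff)
  have assoc: "(a \<otimes>\<^bsub>?R\<^esub> b) \<otimes>\<^bsub>?R\<^esub> c = a \<otimes>\<^bsub>?R\<^esub> (b \<otimes>\<^bsub>?R\<^esub> c)"
    if "a \<in> carrier ?R" "b \<in> carrier ?R" "c \<in> carrier ?R" for a b c
  proof -
    have ka: "Poly_Mapping.keys a \<subseteq> carrier G" and kb: "Poly_Mapping.keys b \<subseteq> carrier G"
      and kc: "Poly_Mapping.keys c \<subseteq> carrier G"
      using that by (auto simp: integral_group_ring_simps)
    have 1: "(frag_of x \<otimes>\<^bsub>?R\<^esub> frag_of y) \<otimes>\<^bsub>?R\<^esub> c = frag_of x \<otimes>\<^bsub>?R\<^esub> (frag_of y \<otimes>\<^bsub>?R\<^esub> c)"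
      if "x \<in> carrier G" "y \<in> carrier G" for x y
      using kc by (induction c rule: frag_induction)
        (use that in \<open>auto simp: integral_group_ring_simps frag_extend_diff m_assoc\<close>)
    have 2: "(frag_of x \<otimes>\<^bsub>?R\<^esub> b) \<otimes>\<^bsub>?R\<^esub> c = frag_of x \<otimes>\<^bsub>?R\<^esub> (b \<otimes>\<^bsub>?R\<^esub> c)"
      if "x \<in> carrier G" for x
      using kb by (induction b rule: frag_induction)
        (use that 1 in \<open>auto simp: integral_group_ring_simps frag_extend_diff\<close>)
    show ?thesis
      using ka by (induction a rule: frag_induction)
        (use 2 in \<open>auto simp: integral_group_ring_simps frag_extend_diff\<close>)
  qed
  have one: "frag_of \<one> \<otimes>\<^bsub>?R\<^esub> a = a" "a \<otimes>\<^bsub>?R\<^esub> frag_of \<one> = a" if "a \<in> carrier ?R" for a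
  proof -
    have "Poly_Mapping.keys a \<subseteq> carrier G"
      using that by (simp add: integral_group_ring_simps)
    then show "frag_of \<one> \<otimes>\<^bsub>?R\<^esub> a = a" "a \<otimes>\<^bsub>?R\<^esub> frag_of \<one> = a"
      by (induction a rule: frag_induction) (auto simp: integral_group_ring_simps frag_extend_diff)
  qed
  have mon: "monoid ?R"
    by unfold_locales
      (use closed assoc one in \<open>auto simp: integral_group_ring_simps keys_frag_of\<close>)
  show ?thesis
    by (rule ringI[OF ag mon])
      (simp_all add: integral_group_ring_simps frag_extend_add frag_extend_fun_add)
qed

lemma augmentation_eq_sum:
  assumes "finite S" "Poly_Mapping.keys a \<subseteq> S"
  shows "augmentation a = (\<Sum>g\<in>S. Poly_Mapping.lookup a g)"
  unfolding augmentation_def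
  by (intro sum.mono_neutral_left) (use assms in \<open>auto simp: in_keys_iff\<close>)

lemma augmentation_diff: "augmentation (a - b) = augmentation a - augmentation b"
proof -
  let ?S = "Poly_Mapping.keys a \<union> Poly_Mapping.keys b"
  have "Poly_Mapping.keys (a - b) \<subseteq> ?S"
    by (rule keys_diff)
  then show ?thesis
    by (simp add: augmentation_eq_sum[of ?S] lookup_minus sum_subtractf)
qed

lemma augmentation_frag_of [simp]: "augmentation (frag_of x) = 1"
  by (simp add: augmentation_def)

lemma augmentation_zero [simp]: "augmentation 0 = 0"
  by (simp add: augmentation_def)

lemma augmentation_mult:
  "augmentation (a \<otimes>\<^bsub>integral_group_ring G\<^esub> b) = augmentation a * augmentation b"
proof -
  have 1: "augmentation (frag_of x \<otimes>\<^bsub>integral_group_ring G\<^esub> b) = augmentation b" for x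
    using subset_UNIV by (induction b rule: frag_induction)
      (auto simp: integral_group_ring_simps frag_extend_diff augmentation_diff)
  show ?thesis
    using subset_UNIV by (induction a rule: frag_induction)
      (use 1 in \<open>auto simp: integral_group_ring_simps frag_extend_diff augmentation_diff algebra_simps\<close>)
qed

lemma (in group) group_normalized_units: "group (normalized_units G)"
proof -
  let ?R = "integral_group_ring G"
  interpret R: ring ?R
    by (rule ring_integral_group_ring)
  interpret U: group "units_of ?R"
    by (rule R.units_group)
  have "subgroup {u \<in> Units ?R. augmentation u = 1} (units_of ?R)"
  proof (rule U.subgroupI)
    show "{u \<in> Units ?R. augmentation u = 1} \<noteq> {}"
      using R.Units_one_closed by (auto simp: integral_group_ring_simps)
  next
    fix u assume u: "u \<in> {u \<in> Units ?R. augmentation u = 1}"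
    then have "augmentation (inv\<^bsub>?R\<^esub> u) * augmentation u = augmentation (\<one>\<^bsub>?R\<^esub>)"
      by (subst augmentation_mult[where G = G, symmetric]) auto
    with u show "inv\<^bsub>units_of ?R\<^esub> u \<in> {u \<in> Units ?R. augmentation u = 1}"
      by (simp add: R.units_of_inv integral_group_ring_simps)
  qed (auto simp: units_of_def augmentation_mult)
  then show ?thesis
    unfolding normalized_units_def by (rule U.subgroup_imp_group)
qed

lemma group_semidirect_product:
  assumes "group N" "group H" and \<phi>: "\<phi> \<in> hom H (AutoGroup N)"
  shows "group (semidirect_product N H \<phi>)"
proof -
  interpret N: group N by fact
  interpret H: group H by fact
  interpret \<phi>: group_hom H "AutoGroup N" \<phi>
    using assms by (simp add: group_hom_def group_hom_axioms_def N.AutoGroup)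
  have auto: "\<phi> h \<in> hom N N" "\<phi> h \<in> Bij (carrier N)" if "h \<in> carrier H" for h
    using \<phi>.hom_closed[OF that] by (auto simp: AutoGroup_def auto_def)
  have closed: "\<phi> h n \<in> carrier N" if "h \<in> carrier H" "n \<in> carrier N" for h n
    using auto(1)[OF that(1)] that(2) by (auto simp: hom_def)
  have distr: "\<phi> h (n \<otimes>\<^bsub>N\<^esub> n') = \<phi> h n \<otimes>\<^bsub>N\<^esub> \<phi> h n'"
    if "h \<in> carrier H" "n \<in> carrier N" "n' \<in> carrier N" for h n n'
    using auto(1)[OF that(1)] that by (auto simp: hom_def)
  have comp: "\<phi> (h \<otimes>\<^bsub>H\<^esub> h') n = \<phi> h (\<phi> h' n)"
    if "h \<in> carrier H" "h' \<in> carrier H" "n \<in> carrier N" for h h' n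
    using that auto by (auto simp: \<phi>.hom_mult AutoGroup_def BijGroup_def compose_def)
  have one: "\<phi> \<one>\<^bsub>H\<^esub> n = n" if "n \<in> carrier N" for n
    using that by (simp add: \<phi>.hom_one) (simp add: AutoGroup_def BijGroup_def)
  show ?thesis
  proof (rule groupI)
    fix x assume "x \<in> carrier (semidirect_product N H \<phi>)"
    then obtain n h where x: "x = (n, h)" "n \<in> carrier N" "h \<in> carrier H"
      by (auto simp: semidirect_product_def)
    then show "\<exists>y\<in>carrier (semidirect_product N H \<phi>).
        y \<otimes>\<^bsub>semidirect_product N H \<phi>\<^esub> x = \<one>\<^bsub>semidirect_product N H \<phi>\<^esub>"
      by (intro bexI[of _ "(inv\<^bsub>N\<^esub> (\<phi> (inv\<^bsub>H\<^esub> h) n), inv\<^bsub>H\<^esub> h)"])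
        (auto simp: semidirect_product_def closed simp del: \<phi>.hom_inv)
  qed (auto simp: semidirect_product_def closed distr comp one N.m_assoc H.m_assoc
      simp del: \<phi>.hom_mult \<phi>.hom_one)
qed

end

theory Submission
  imports Defs
begin

text \<open>
  In fact every finite subgroup of \<open>V(\<int>G)\<close> embeds in \<open>G\<close>. Let \<open>G' = \<langle>c\<rangle>\<close> have order \<open>n\<close>. By a
  relative Berman-Higman theorem (a torsion unit of augmentation \<open>1\<close> with nonzero coefficient at \<open>1\<close>
  is trivial), a torsion unit \<open>u\<close> is congruent to some \<open>g\<close> modulo the ideal generated by \<open>c - 1\<close>.
  Adjusting \<open>g\<close> by a power of \<open>c\<close>, we get Whitcomb's congruence \<open>u - g = x(c - 1)\<close> with \<open>n\<close> dividing
  the augmentation of \<open>x\<close>. It determines \<open>g\<close> and is multiplicative, so it defines a homomorphism on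
  each finite group of units.

  For injectivity let \<open>u - 1 = x(c - 1)\<close> be torsion, \<open>n\<close> dividing the augmentation of \<open>x\<close>. Write
  \<open>N d\<close> for the sum of the elements of \<open>\<langle>c^d\<rangle>\<close>. Starting from \<open>u (N 1) = N 1\<close>, one passes from \<open>d\<close> to
  \<open>d r\<close> with \<open>r\<close> prime: \<open>u - 1 = Y(z - 1)\<close> with \<open>z = c^d\<close> and \<open>r\<close> dividing the augmentation of \<open>Y\<close>.
  Modulo \<open>r\<close> one sees that \<open>u^r\<close> fixes \<open>N (d r)\<close>. If \<open>u\<close> did not, Berman-Higman would make the
  \<open>u^j N (d r)\<close>, \<open>j < r\<close>, orthogonal for a \<open>u\<close>-invariant form, whence
  \<open>(\<Sum>j<r. u^j) N (d r) = N d\<close>; but modulo \<open>r\<close> the left side is \<open>W (N d)\<close> with \<open>r\<close> dividing the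
  augmentation of \<open>W\<close>, a contradiction.
\<close>

subsection \<open>Group rings of additively written groups\<close>

text \<open>
  The product on \<^typ>\<open>'k \<Rightarrow>\<^sub>0 int\<close> is the group ring product for \<open>'k :: group_add\<close>, a class of not
  necessarily commutative groups. Groups are therefore written additively in this development, and
  the ring element \<open>1\<close> is the basis element of \<open>0\<close>.
\<close>

lemma frag_induct [case_names zero one diff]:
  assumes "P 0" "\<And>x. P (frag_of x)" "\<And>a b. P a \<Longrightarrow> P b \<Longrightarrow> P (a - b)"
  shows "P a"
  using subset_UNIV assms by (rule frag_induction)

lemma frag_of_mult: "frag_of (g :: 'k::monoid_add) * frag_of h = frag_of (g + h)"
  by (simp add: mult_single)

lemma frag_of_zero: "frag_of (0 :: 'k::monoid_add) = 1"
  by simp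

section \<open>Augmentation and integer multiples\<close>

lemma augmentation_add: "augmentation (a + b) = augmentation a + augmentation b"
  using augmentation_diff[of "a + b" b] by simp

lemma augmentation_sum: "augmentation (sum f A) = (\<Sum>i\<in>A. augmentation (f i))"
  by (induction A rule: infinite_finite_induct) (auto simp: augmentation_add)

lemma augmentation_times:
  "augmentation (a * b) = augmentation (a :: 'k::monoid_add \<Rightarrow>\<^sub>0 int) * augmentation b"
proof -
  have 1: "augmentation (frag_of x * b) = augmentation b" for x :: 'k
    by (induction b rule: frag_induct) (auto simp: frag_of_mult augmentation_diff right_diff_distrib)
  show ?thesis
    by (induction a rule: frag_induct) (auto simp: 1 augmentation_diff left_diff_distrib)
qed

lemma augmentation_one [simp]: "augmentation (1 :: 'k::monoid_add \<Rightarrow>\<^sub>0 int) = 1"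
  by (metis frag_of_zero augmentation_frag_of)

lemma augmentation_power: "augmentation ((a :: 'k::monoid_add \<Rightarrow>\<^sub>0 int) ^ i) = augmentation a ^ i"
  by (induction i) (auto simp: augmentation_times)

lemma augmentation_of_int [simp]: "augmentation (of_int i :: 'k::monoid_add \<Rightarrow>\<^sub>0 int) = i"
proof -
  have "augmentation (of_nat n :: 'k \<Rightarrow>\<^sub>0 int) = int n" for n
    by (induction n) (auto simp: augmentation_add)
  moreover have "augmentation (- a) = - augmentation a" for a :: "'k \<Rightarrow>\<^sub>0 int"
    using augmentation_diff[of 0 a] by simp
  ultimately show ?thesis
    by (cases i) (auto simp del: of_nat_Suc)
qed

lemma augmentation_of_nat [simp]: "augmentation (of_nat n :: 'k::monoid_add \<Rightarrow>\<^sub>0 int) = int n"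
  using augmentation_of_int[of "int n"] by simp

lemma lookup_of_int_times:
  "Poly_Mapping.lookup (of_int i * a) g = i * Poly_Mapping.lookup (a :: 'k::monoid_add \<Rightarrow>\<^sub>0 int) g"
proof -
  have 1: "Poly_Mapping.lookup (of_nat n * a) g = int n * Poly_Mapping.lookup a g" for n
    by (induction n) (auto simp: lookup_add algebra_simps)
  show ?thesis
    by (cases i) (use 1[of "Suc _"] 1 in \<open>auto simp del: of_nat_Suc\<close>)
qed

lemma lookup_of_nat_times:
  "Poly_Mapping.lookup (of_nat n * a) g = int n * Poly_Mapping.lookup (a :: 'k::monoid_add \<Rightarrow>\<^sub>0 int) g"
  using lookup_of_int_times[of "int n"] by simp

lemma of_int_times_eq_0_iff [simp]:
  "of_int i * (a :: 'k::monoid_add \<Rightarrow>\<^sub>0 int) = 0 \<longleftrightarrow> i = 0 \<or> a = 0"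
proof
  assume "of_int i * a = 0"
  then have "i * Poly_Mapping.lookup a g = 0" for g
    by (metis lookup_of_int_times lookup_zero)
  then show "i = 0 \<or> a = 0"
    by (auto intro: poly_mapping_eqI)
qed auto

lemma of_nat_times_eq_0_iff [simp]:
  "of_nat n * (a :: 'k::monoid_add \<Rightarrow>\<^sub>0 int) = 0 \<longleftrightarrow> n = 0 \<or> a = 0"
  using of_int_times_eq_0_iff[of "int n" a] by simp

lemma of_nat_times_cancel:
  "n > 0 \<Longrightarrow> of_nat n * a = of_nat n * b \<Longrightarrow> a = (b :: 'k::monoid_add \<Rightarrow>\<^sub>0 int)"
  using of_nat_times_eq_0_iff[of n "a - b"] by (simp add: right_diff_distrib)

lemma of_int_commute: "x * of_int i = of_int i * (x :: 'r::ring_1)"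
  by (rule mult_of_int_commute[symmetric])

lemma of_nat_commute: "x * of_nat i = of_nat i * (x :: 'r::ring_1)"
  by (rule mult_of_nat_commute[symmetric])

section \<open>Trace, involution and the inner product on coefficients\<close>

abbreviation tr :: "('k::zero \<Rightarrow>\<^sub>0 int) \<Rightarrow> int"
  where "tr a \<equiv> Poly_Mapping.lookup a 0"

lemma tr_commute: "tr (a * b) = tr (b * (a :: 'k::group_add \<Rightarrow>\<^sub>0 int))"
proof -
  have comm: "0 = x + y \<longleftrightarrow> 0 = y + x" for x y :: 'k
    by (metis neg_eq_iff_add_eq_0 eq_neg_iff_add_eq_0)
  have 1: "tr (frag_of x * b) = tr (b * frag_of x)" for x :: 'k
    by (induction b rule: frag_induct)
      (auto simp: frag_of_mult lookup_minus right_diff_distrib left_diff_distrib comm)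
  show ?thesis
    by (induction a rule: frag_induct) (auto simp: 1 lookup_minus right_diff_distrib left_diff_distrib)
qed

text \<open>The standard anti-involution of the group ring. Left multiplication by
  \<open>star a\<close> is adjoint to left multiplication by \<open>a\<close> for the inner product
  computed in \<open>tr_star_times\<close>.\<close>

definition star :: "('k::group_add \<Rightarrow>\<^sub>0 int) \<Rightarrow> 'k \<Rightarrow>\<^sub>0 int"
  where "star = frag_extend (\<lambda>g. frag_of (- g))"

lemma star_simps [simp]:
  "star 0 = 0" "star (frag_of g) = frag_of (- g)" "star (a - b) = star a - star b"
  "star (a + b) = star a + star b" "star 1 = 1"
proof -
  show "star 1 = 1"
    unfolding star_def frag_of_zero[symmetric] frag_extend_of by simp
qed (simp_all only: star_def frag_extend_0 frag_extend_of frag_extend_diff frag_extend_add)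

lemma star_star [simp]: "star (star a) = a"
  by (induction a rule: frag_induct) (auto)

lemma star_times: "star (a * b) = star b * star a"
proof -
  have 1: "star (frag_of x * b) = star b * star (frag_of x)" for x
    by (induction b rule: frag_induct)
      (auto simp: frag_of_mult right_diff_distrib left_diff_distrib minus_add)
  show ?thesis
    by (induction a rule: frag_induct) (auto simp: 1 right_diff_distrib left_diff_distrib)
qed

lemma star_sum: "star (sum f A) = (\<Sum>i\<in>A. star (f i))"
  by (induction A rule: infinite_finite_induct) auto

lemma star_of_int [simp]: "star (of_int i :: 'k::group_add \<Rightarrow>\<^sub>0 int) = of_int i"
proof -
  have 1: "star (of_nat n :: 'k \<Rightarrow>\<^sub>0 int) = of_nat n" for n
    by (induction n) auto
  have "star (- a) = - star a" for a :: "'k \<Rightarrow>\<^sub>0 int"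
    using star_simps(3)[of 0 a] by simp
  then show ?thesis
    by (cases i) (auto simp: 1 simp del: of_nat_Suc)
qed

lemma tr_star [simp]: "tr (star a) = tr a"
  by (induction a rule: frag_induct) (auto simp: lookup_minus)

lemma tr_star_times:
  assumes "finite F" "Poly_Mapping.keys a \<subseteq> F"
  shows "tr (star a * b) = (\<Sum>g\<in>F. Poly_Mapping.lookup a g * Poly_Mapping.lookup b g)"
proof -
  have eq: "0 = - g + x \<longleftrightarrow> g = x" for g x :: 'a
    by (metis add.inverse_inverse neg_eq_iff_add_eq_0)
  have 1: "tr (frag_of (- g) * b) = Poly_Mapping.lookup b g" for g
    by (induction b rule: frag_induct)
      (auto simp: frag_of_mult lookup_minus right_diff_distrib eq)
  from assms(2) show ?thesis
  proof (induction a rule: frag_induction)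
    case (one x)
    have "(\<Sum>g\<in>F. Poly_Mapping.lookup (frag_of x) g * Poly_Mapping.lookup b g)
      = (\<Sum>g\<in>F. if x = g then Poly_Mapping.lookup b g else 0)"
      by (intro sum.cong) auto
    then show ?case
      using one assms(1) by (simp add: 1)
  next
    case (diff a b')
    then show ?case
      by (simp add: left_diff_distrib lookup_minus sum_subtractf)
  qed auto
qed

lemma tr_star_times_self_nonneg: "tr (star a * a) \<ge> 0"
  by (subst tr_star_times[OF finite_keys order.refl]) (auto intro: sum_nonneg)

lemma tr_star_times_self_eq_0_iff: "tr (star a * a) = 0 \<longleftrightarrow> a = 0"
proof
  assume "tr (star a * a) = 0"
  then have "\<forall>g\<in>Poly_Mapping.keys a. Poly_Mapping.lookup a g * Poly_Mapping.lookup a g = 0"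
    by (subst (asm) tr_star_times[OF finite_keys order.refl])
      (subst (asm) sum_nonneg_eq_0_iff, auto)
  then show "a = 0"
    by (metis in_keys_iff mult_eq_0_iff poly_mapping_eqI lookup_zero)
qed auto

subsection \<open>Invariant forms and the Berman-Higman theorem\<close>

text \<open>Gaussian elimination without fractions: a homogeneous integer system with more unknowns
  than equations has a nonzero integer solution. It replaces linear algebra over the rationals
  below.\<close>

lemma integer_dependency:
  fixes M :: "'j \<Rightarrow> 'i \<Rightarrow> int"
  assumes "finite J" "finite I" "card J < card I"
  shows "\<exists>y. (\<exists>i\<in>I. y i \<noteq> 0) \<and> (\<forall>j\<in>J. (\<Sum>i\<in>I. M j i * y i) = 0)"
  using assms
proof (induction J arbitrary: I M rule: finite_induct)
  case empty
  then obtain i where "i \<in> I"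
    by fastforce
  then show ?case
    by (intro exI[of _ "\<lambda>_. 1"]) auto
next
  case (insert j J)
  show ?case
  proof (cases "\<forall>i\<in>I. M j i = 0")
    case True
    have "card J < card I"
      using insert.prems insert.hyps by simp
    from insert.IH[OF insert.prems(1) this]
    obtain y where "\<exists>i\<in>I. y i \<noteq> 0" "\<forall>j\<in>J. (\<Sum>i\<in>I. M j i * y i) = 0"
      by blast
    with True show ?thesis
      by (intro exI[of _ y]) auto
  next
    case False
    then obtain k where k: "k \<in> I" "M j k \<noteq> 0"
      by blast
    \<comment> \<open>Unknown \<open>k\<close> is eliminated from each row \<open>j'\<close> by
      cross-multiplying with the pivot row \<open>j\<close>, which keeps all entries
      integral.\<close>
    define M' where "M' = (\<lambda>j' i. M j k * M j' i - M j' k * M j i)"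
    have "card J < card (I - {k})"
      using insert k by simp
    then obtain y where y: "\<exists>i\<in>I - {k}. y i \<noteq> 0" "\<forall>j\<in>J. (\<Sum>i\<in>I - {k}. M' j i * y i) = 0"
      using insert.IH[of "I - {k}" M'] insert.prems by auto
    define s where "s = (\<Sum>i\<in>I - {k}. M j i * y i)"
    \<comment> \<open>The reduced solution is scaled by the pivot \<open>M j k\<close>, so that the
      value \<open>- s\<close> at \<open>k\<close> solves row \<open>j\<close> without
      division.\<close>
    define y' where "y' = (\<lambda>i. if i = k then - s else M j k * y i)"
    have sum: "(\<Sum>i\<in>I. M j' i * y' i) = - M j' k * s + M j k * (\<Sum>i\<in>I - {k}. M j' i * y i)" for j'
      by (subst sum.remove[OF insert.prems(1) k(1)])
        (auto simp: y'_def sum_distrib_left algebra_simps intro!: sum.cong)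
    have "(\<Sum>i\<in>I. M j' i * y' i) = 0" if "j' \<in> J" for j'
    proof -
      have "0 = (\<Sum>i\<in>I - {k}. M' j' i * y i)"
        using y(2) that by auto
      also have "\<dots> = M j k * (\<Sum>i\<in>I - {k}. M j' i * y i) - M j' k * s"
        by (simp add: M'_def s_def sum_distrib_left algebra_simps sum_subtractf)
      finally show ?thesis
        by (simp add: sum)
    qed
    moreover have "(\<Sum>i\<in>I. M j i * y' i) = 0"
      by (simp add: sum s_def)
    moreover have "\<exists>i\<in>I. y' i \<noteq> 0"
      using y(1) k by (auto simp: y'_def)
    ultimately show ?thesis
      by auto
  qed
qed

section \<open>The group ring of a finite subgroup and inverses up to an integer factor\<close>

locale finite_subgroup =
  fixes H :: "'k::group_add set"
  assumes finite_H: "finite H"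
    and zero_mem: "0 \<in> H"
    and add_mem: "g \<in> H \<Longrightarrow> h \<in> H \<Longrightarrow> g + h \<in> H"
    and uminus_mem: "g \<in> H \<Longrightarrow> - g \<in> H"
begin

definition ZH :: "('k \<Rightarrow>\<^sub>0 int) set"
  where "ZH = {a. Poly_Mapping.keys a \<subseteq> H}"

lemma ZH_frag_of [simp]: "frag_of g \<in> ZH \<longleftrightarrow> g \<in> H"
  by (simp add: ZH_def)

lemma ZH_0 [simp]: "0 \<in> ZH"
  by (simp add: ZH_def)

lemma ZH_1 [simp]: "1 \<in> ZH"
  by (simp add: ZH_def zero_mem)

lemma ZH_add [intro, simp]: "a \<in> ZH \<Longrightarrow> b \<in> ZH \<Longrightarrow> a + b \<in> ZH"
  using keys_add[of a b] by (auto simp: ZH_def)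

lemma ZH_diff [intro, simp]: "a \<in> ZH \<Longrightarrow> b \<in> ZH \<Longrightarrow> a - b \<in> ZH"
  using keys_diff[of a b] by (auto simp: ZH_def)

lemma ZH_uminus [intro, simp]: "a \<in> ZH \<Longrightarrow> - a \<in> ZH"
  by (auto simp: ZH_def)

lemma ZH_times [intro, simp]: "a \<in> ZH \<Longrightarrow> b \<in> ZH \<Longrightarrow> a * b \<in> ZH"
  using keys_mult[of a b] by (fastforce simp: ZH_def intro: add_mem)

lemma ZH_power [intro, simp]: "a \<in> ZH \<Longrightarrow> a ^ i \<in> ZH"
  by (induction i) auto

lemma ZH_sum [intro]: "(\<And>i. i \<in> A \<Longrightarrow> f i \<in> ZH) \<Longrightarrow> sum f A \<in> ZH"
  by (induction A rule: infinite_finite_induct) auto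

lemma ZH_of_nat [simp]: "of_nat i \<in> ZH"
  by (induction i) auto

lemma ZH_of_int [simp]: "of_int i \<in> ZH"
  by (cases i) (auto simp del: of_nat_Suc)

lemma ZH_induct [consumes 1, case_names zero one diff]:
  assumes "a \<in> ZH" "P 0" "\<And>g. g \<in> H \<Longrightarrow> P (frag_of g)" "\<And>a b. P a \<Longrightarrow> P b \<Longrightarrow> P (a - b)"
  shows "P a"
  using assms by (auto simp: ZH_def intro: frag_induction)

lemma ZH_star [intro, simp]: "a \<in> ZH \<Longrightarrow> star a \<in> ZH"
  unfolding star_def ZH_def using keys_frag_extend uminus_mem by fastforce

text \<open>Left multiplication by \<open>P\<close> is injective on a lattice of finite rank, hence
  invertible over the rationals; \<open>S\<close> is the inverse of \<open>P\<close> with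
  denominators cleared.\<close>

lemma scaled_inverse:
  assumes P: "P \<in> ZH" "star P = P" and inj: "\<And>x. x \<in> ZH \<Longrightarrow> P * x = 0 \<Longrightarrow> x = 0"
  obtains S m where "S \<in> ZH" "m > 0" "P * S = of_int m" "S * P = of_int m" "star S = S"
proof -
  \<comment> \<open>The unknowns are the coefficients of \<open>x\<close> (indices
    \<open>Some g\<close>) and a scalar \<open>t\<close> (index \<open>None\<close>). The equations,
    one for each element of \<open>H\<close>, say \<open>P * x = of_int t\<close>, so there is one
    unknown more than equations.\<close>
  define M where "M = (\<lambda>k i. case i of None \<Rightarrow> if k = 0 then - 1 else 0
    | Some g \<Rightarrow> Poly_Mapping.lookup (P * frag_of g) k)"
  have "card H < card (insert None (Some ` H))"
    using finite_H by (simp add: card_image)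
  then obtain y where y: "\<exists>i\<in>insert None (Some ` H). y i \<noteq> 0"
      "\<forall>k\<in>H. (\<Sum>i\<in>insert None (Some ` H). M k i * y i) = 0"
    using integer_dependency[of H "insert None (Some ` H)" M] finite_H by auto
  define x where "x = (\<Sum>g\<in>H. of_int (y (Some g)) * frag_of g)"
  define t where "t = y None"
  have x: "x \<in> ZH"
    unfolding x_def by (intro ZH_sum) auto
  have lookup_x: "Poly_Mapping.lookup x g = y (Some g)" if "g \<in> H" for g
  proof -
    have "Poly_Mapping.lookup x g = (\<Sum>h\<in>H. if h = g then y (Some h) else 0)"
      unfolding x_def by (auto simp: lookup_sum lookup_of_int_times intro!: sum.cong)
    then show ?thesis
      using that finite_H by simp
  qed
  have Px: "P * x = of_int t"
  proof (rule poly_mapping_eqI)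
    fix k
    have "P * x = (\<Sum>g\<in>H. of_int (y (Some g)) * (P * frag_of g))"
      unfolding x_def by (simp add: sum_distrib_left mult.assoc[symmetric] of_int_commute)
    then have 1: "Poly_Mapping.lookup (P * x) k = (\<Sum>g\<in>H. M k (Some g) * y (Some g))"
      by (simp add: lookup_sum lookup_of_int_times M_def mult.commute)
    show "Poly_Mapping.lookup (P * x) k = Poly_Mapping.lookup (of_int t) k"
    proof (cases "k \<in> H")
      case True
      then have "0 = M k None * y None + (\<Sum>g\<in>H. M k (Some g) * y (Some g))"
        using y(2) finite_H by (simp add: sum.reindex)
      then show ?thesis
        by (auto simp: 1 lookup_of_int M_def t_def when_def split: if_splits)
    next
      case False
      then have "k \<noteq> 0" "k \<notin> Poly_Mapping.keys (P * x)"
        using zero_mem ZH_times[OF P(1) x] by (auto simp: ZH_def)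
      then show ?thesis
        by (simp add: lookup_of_int in_keys_iff)
    qed
  qed
  \<comment> \<open>With \<open>t = 0\<close>, injectivity would force \<open>x = 0\<close>, and
    then every unknown would vanish.\<close>
  have "t \<noteq> 0"
  proof
    assume "t = 0"
    then have "x = 0"
      using inj[OF x] Px by simp
    then show False
      using y(1) lookup_x \<open>t = 0\<close> by (auto simp: t_def)
  qed
  define S where "S = of_int (sgn t) * x"
  define m where "m = \<bar>t\<bar>"
  have S: "S \<in> ZH" and m: "m > 0"
    using x \<open>t \<noteq> 0\<close> by (auto simp: S_def m_def)
  have "P * S = of_int (sgn t) * (P * x)"
    by (simp add: S_def mult.assoc[symmetric] of_int_commute)
  also have "\<dots> = of_int (sgn t * t)"
    by (simp add: Px)
  also have "sgn t * t = m"
    by (simp add: m_def sgn_if)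
  finally have PS: "P * S = of_int m" .
  have S'P: "star S * P = of_int m"
    using arg_cong[OF PS, of star] by (simp add: star_times P)
  \<comment> \<open>A left inverse agrees with a right inverse: \<open>star S * P * S\<close> is
    evaluated in two ways.\<close>
  have "of_int m * S = star S * (P * S)"
    by (simp add: S'P mult.assoc[symmetric])
  then have "of_int m * star S = of_int m * S"
    by (simp add: PS of_int_commute)
  then have "of_int m * (star S - S) = 0"
    by (simp add: right_diff_distrib)
  then have "star S = S"
    using m by simp
  with that[OF S m PS] S'P show thesis
    by simp
qed

end

text \<open>A positive definite form that \<open>v\<close> preserves on multiples of
  \<open>N\<close>. The factor \<open>m\<close> keeps it integral, and \<open>form_central\<close>
  keeps the trace accessible: pairing with a central self-adjoint element still reads off a
  coefficient at \<open>0\<close>.\<close>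

locale invariant_form = finite_subgroup H for H :: "'k::group_add set" +
  fixes v N :: "'k \<Rightarrow>\<^sub>0 int" and form :: "('k \<Rightarrow>\<^sub>0 int) \<Rightarrow> ('k \<Rightarrow>\<^sub>0 int) \<Rightarrow> int" and m :: int
  assumes scale_pos: "m > 0"
    and form_add: "form (x + y) z = form x z + form y z"
    and form_commute: "form x y = form y x"
    and form_nonneg: "form x x \<ge> 0"
    and form_eq_0: "form x x = 0 \<Longrightarrow> x = 0"
    and form_invariant: "form (v * N * x) (v * N * y) = form (N * x) (N * y)"
    and form_central: "(\<And>x. x \<in> ZH \<Longrightarrow> z * x = x * z) \<Longrightarrow> star z = z \<Longrightarrow> form z y = m * tr (z * y)"
begin

lemma form_add_right: "form x (y + z) = form x y + form x z"
  by (simp add: form_add form_commute[of x])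

lemma form_0 [simp]: "form 0 x = 0" "form x 0 = 0"
  using form_add[of 0 0 x] form_commute[of x 0] by simp_all

lemma form_diff: "form (x - y) z = form x z - form y z"
  using form_add[of "x - y" y z] by simp

lemma form_diff_right: "form z (x - y) = form z x - form z y"
  using form_add_right[of z "x - y" y] by simp

lemma form_sum: "form (sum f A) z = (\<Sum>i\<in>A. form (f i) z)"
  by (induction A rule: infinite_finite_induct) (auto simp: form_add)

lemma form_sum_right: "form z (sum f A) = (\<Sum>i\<in>A. form z (f i))"
  by (induction A rule: infinite_finite_induct) (auto simp: form_add_right)

end

context finite_subgroup
begin

text \<open>
  For an honest torsion unit \<open>v\<close> (the case \<open>N = 1\<close>) this is the form \<open>m \<cdot> tr (P\<^sup>-\<^sup>1 x\<^sup>* P y)\<close> with the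
  \<open>v\<close>-invariant \<open>P = (\<Sum>j<n. (v^j)\<^sup>* v^j)\<close>; it makes \<open>v\<close> orthogonal without disturbing the trace.
\<close>

lemma ex_invariant_form:
  assumes v: "v \<in> ZH" and N: "N \<in> ZH" "star N = N" and central: "\<And>x. x \<in> ZH \<Longrightarrow> N * x = x * N"
    and vn: "v ^ n * N = N" "n > 0"
  shows "\<exists>form m. invariant_form H v N form m"
proof -
  define P where "P = (\<Sum>j<n. star (v ^ j) * v ^ j)"
  have P: "P \<in> ZH" "star P = P"
    unfolding P_def by (auto simp: star_sum star_times v)
  define q where "q = (\<lambda>x. tr (star x * P * x))"
  have q: "q x = (\<Sum>j<n. tr (star (v ^ j * x) * (v ^ j * x)))" for x
    unfolding q_def P_def
    by (simp add: sum_distrib_left sum_distrib_right lookup_sum star_times mult.assoc)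
  \<comment> \<open>The summand \<open>j = 0\<close>, present because \<open>n > 0\<close>, is
    already \<open>tr (star x * x)\<close>; this makes \<open>q\<close> definite and hence
    \<open>P\<close> injective.\<close>
  have q_ge: "q x \<ge> tr (star x * x)" for x
    unfolding q using vn(2) member_le_sum[of 0 "{..<n}" "\<lambda>j. tr (star (v ^ j * x) * (v ^ j * x))"]
      tr_star_times_self_nonneg by auto
  have q_nonneg: "q x \<ge> 0" for x
    using q_ge[of x] tr_star_times_self_nonneg[of x] by simp
  have q_0: "x = 0" if "q x = 0" for x
    using that q_ge[of x] tr_star_times_self_nonneg[of x] tr_star_times_self_eq_0_iff[of x] by simp
  have "x = 0" if "P * x = 0" for x
    using that by (intro q_0) (simp add: q_def mult.assoc)
  then obtain S m where S: "S \<in> ZH" "m > 0" "P * S = of_int m" "S * P = of_int m" "star S = S"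
    using scaled_inverse[OF P] by blast
  define form where "form = (\<lambda>x y. tr (S * star x * P * y))"
  have sym: "form x y = form y x" for x y
  proof -
    have "form x y = tr (star (S * star x * P * y))"
      by (simp add: form_def)
    also have "\<dots> = tr (star y * P * x * S)"
      by (simp add: star_times P S mult.assoc)
    also have "\<dots> = form y x"
      using tr_commute[of "star y * P * x" S] by (simp add: form_def mult.assoc)
    finally show ?thesis .
  qed
  \<comment> \<open>The factor \<open>m\<close> is written as \<open>S * P\<close> and this second
    copy of \<open>P\<close> is expanded into its summands; cyclicity of the trace turns each term
    into a value of \<open>q\<close>.\<close>
  have self: "m * form x x = (\<Sum>j<n. q (x * S * star (v ^ j)))" for x
  proof -
    have "m * form x x = tr ((S * P) * S * star x * P * x)"
      by (simp add: S form_def lookup_of_int_times mult.assoc)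
    also have "\<dots> = (\<Sum>j<n. tr ((S * star (v ^ j)) * (v ^ j * S * star x * P * x)))"
      unfolding P_def[THEN arg_cong[of _ _ "\<lambda>P. S * P"]]
      by (simp add: sum_distrib_left sum_distrib_right lookup_sum mult.assoc)
    also have "\<dots> = (\<Sum>j<n. q (x * S * star (v ^ j)))"
      unfolding q_def by (subst tr_commute) (simp add: star_times S mult.assoc)
    finally show ?thesis .
  qed
  have nonneg: "form x x \<ge> 0" for x
  proof -
    have "m * form x x \<ge> 0"
      unfolding self by (intro sum_nonneg q_nonneg)
    then show ?thesis
      using S(2) by (simp add: zero_le_mult_iff)
  qed
  have def: "x = 0" if "form x x = 0" for x
  proof -
    have "(\<Sum>j<n. q (x * S * star (v ^ j))) = 0"
      using self[of x] that by simp
    then have "\<forall>j\<in>{..<n}. q (x * S * star (v ^ j)) = 0"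
      by (subst (asm) sum_nonneg_eq_0_iff) (auto intro: q_nonneg)
    then have "q (x * S * star (v ^ 0)) = 0"
      using vn(2) by blast
    then have "x * S = 0"
      using q_0 by simp
    then have "x * (S * P) = 0"
      by (simp add: mult.assoc[symmetric])
    then show "x = 0"
      using S by (simp add: of_int_commute)
  qed
  \<comment> \<open>Conjugation shifts the index in the sum \<open>P\<close>, replacing the term
    \<open>j = 0\<close> by the term \<open>j = n\<close>. Both agree after multiplication by
    \<open>N\<close>, since \<open>N\<close> is central and self-adjoint and
    \<open>v ^ n * N = N\<close>.\<close>
  have vP: "star v * P * v * N = P * N"
  proof -
    have "star (v ^ n) * (v ^ n * N) = N * star (v ^ n)"
      unfolding vn(1) by (rule central[symmetric]) (use v in auto)
    also have "\<dots> = star (v ^ n * N)"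
      by (simp only: star_times N)
    finally have last: "star (v ^ n) * v ^ n * N = star (v ^ 0) * v ^ 0 * N"
      by (simp add: vn N mult.assoc)
    have "star v * P * v * N = (\<Sum>j<n. star (v ^ Suc j) * v ^ Suc j * N)"
      unfolding P_def
      by (simp only: sum_distrib_left sum_distrib_right power_Suc2 star_times mult.assoc)
    also have "\<dots> = (\<Sum>j<Suc n. star (v ^ j) * v ^ j * N) - star (v ^ 0) * v ^ 0 * N"
      using sum.lessThan_Suc_shift[of "\<lambda>j. star (v ^ j) * v ^ j * N" n] by simp
    also have "\<dots> = P * N"
      unfolding P_def by (simp only: sum.lessThan_Suc last sum_distrib_right) simp
    finally show ?thesis .
  qed
  have "invariant_form H v N form m"
  proof
    show "m > 0"
      by fact
    fix x y z
    show "form (x + y) z = form x z + form y z"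
      by (simp add: form_def distrib_left distrib_right lookup_add)
    show "form x y = form y x"
      by (fact sym)
    show "form x x \<ge> 0"
      by (fact nonneg)
    show "x = 0" if "form x x = 0"
      using that by (rule def)
    have "form (v * N * x) (v * N * y) = tr (S * star x * N * (star v * P * v * N) * y)"
      by (simp add: form_def star_times N mult.assoc)
    also have "\<dots> = form (N * x) (N * y)"
      by (simp only: vP) (simp add: form_def star_times N mult.assoc)
    finally show "form (v * N * x) (v * N * y) = form (N * x) (N * y)" .
    assume z: "\<And>x. x \<in> ZH \<Longrightarrow> z * x = x * z" "star z = z"
    have "S * z * P * y = z * (S * P) * y"
      by (simp only: z(1)[OF S(1), symmetric] mult.assoc)
    also have "\<dots> = of_int m * (z * y)"
      by (simp only: S of_int_commute mult.assoc)
    finally show "form z y = m * tr (z * y)"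
      by (simp add: form_def z lookup_of_int_times)
  qed
  then show ?thesis
    by blast
qed

text \<open>\<open>N\<close> and \<open>v * N\<close> have the same square length, and their pairing
  is that length times the integer \<open>tr (v * N)\<close>. As this integer is nonzero,
  \<open>N - v * N\<close> or \<open>N + v * N\<close> has nonpositive square length and vanishes;
  the augmentation excludes the second case.\<close>

lemma berman_higman:
  assumes v: "v \<in> ZH" and N: "N \<in> ZH" "star N = N" and central: "\<And>x. x \<in> ZH \<Longrightarrow> N * x = x * N"
    and N2: "N * N = of_nat b * N" "b > 0" and tr_N: "tr N = 1"
    and vn: "v ^ n * N = N" "n > 0"
    and aug: "augmentation v = 1" "augmentation N \<noteq> 0" and nz: "tr (v * N) \<noteq> 0"
  shows "v * N = N"
proof -
  obtain form m where "invariant_form H v N form m"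
    using ex_invariant_form[OF v N central vn] by blast
  then interpret invariant_form H v N form m .
  have vv: "form (v * N) (v * N) = m * int b"
    using form_invariant[of 1 1] by (simp add: form_central[OF central N(2)] N2 lookup_of_nat_times tr_N)
  have NN: "form N N = m * int b"
    by (simp add: form_central[OF central N(2)] N2 lookup_of_nat_times tr_N)
  have "N * (v * N) = of_nat b * (v * N)"
    by (metis N2(1) central mult.assoc of_nat_commute v)
  then have Nv: "form N (v * N) = m * int b * tr (v * N)"
    by (simp add: form_central[OF central N(2)] lookup_of_nat_times)
  have plus: "form (N + v * N) (N + v * N) = 2 * (m * int b) * (1 + tr (v * N))"
    by (simp add: form_add form_add_right form_commute[of "v * N" N] NN vv Nv algebra_simps)
  have minus: "form (N - v * N) (N - v * N) = 2 * (m * int b) * (1 - tr (v * N))"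
    by (simp add: form_diff form_diff_right form_commute[of "v * N" N] NN vv Nv algebra_simps)
  have mb: "m * int b > 0"
    using scale_pos N2 by simp
  consider "tr (v * N) \<ge> 1" | "tr (v * N) \<le> - 1"
    using nz by linarith
  then show ?thesis
  proof cases
    case 1
    then have "form (N - v * N) (N - v * N) \<le> 0"
      using minus mb by (simp add: mult_nonneg_nonpos)
    then have "N - v * N = 0"
      using form_nonneg form_eq_0 by (meson order_antisym)
    then show ?thesis by simp
  next
    case 2
    then have "form (N + v * N) (N + v * N) \<le> 0"
      using plus mb by (simp add: mult_nonneg_nonpos)
    then have "N + v * N = 0"
      using form_nonneg form_eq_0 by (meson order_antisym)
    then have "augmentation (N + v * N) = 0"
      by simp
    then show ?thesis
      using aug by (simp add: augmentation_add augmentation_times)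
  qed
qed

end

subsection \<open>Geometric sums and cyclic subgroups\<close>

lemma power_commutes_twist: "x * y = y * w \<Longrightarrow> x ^ i * y = y * w ^ i" for x y w :: "'r::monoid_mult"
proof (induction i)
  case (Suc i)
  have "x ^ Suc i * y = x * (y * w ^ i)"
    by (simp only: power_Suc mult.assoc Suc.IH[OF Suc.prems])
  also have "\<dots> = y * w ^ Suc i"
    by (simp only: mult.assoc[symmetric] Suc.prems power_Suc)
  finally show ?case .
qed auto

lemma geometric_sum_mult:
  "(w - 1) * (\<Sum>j<n. w ^ j) = w ^ n - (1 :: 'r::ring_1)"
  "(\<Sum>j<n. w ^ j) * (w - 1) = w ^ n - (1 :: 'r::ring_1)"
  by (induction n) (simp_all add: algebra_simps power_commutes)

lemma geometric_sum_add:
  "(\<Sum>i<m + n. w ^ i) = (\<Sum>i<m. w ^ i) + w ^ m * (\<Sum>i<n. (w :: 'r::semiring_1) ^ i)"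
  by (induction n) (simp_all add: distrib_left add.assoc power_add)

lemma geometric_sum_times:
  "(\<Sum>i<m * n. w ^ i) = (\<Sum>i<m. w ^ i) * (\<Sum>i<n. ((w :: 'r::semiring_1) ^ m) ^ i)"
proof (induction n)
  case (Suc n)
  have "w ^ (m * n) * (\<Sum>i<m. w ^ i) = (\<Sum>i<m. w ^ i) * (w ^ m) ^ n"
    by (simp add: sum_distrib_left sum_distrib_right power_mult[symmetric] power_add[symmetric] add.commute)
  then show ?case
    using Suc geometric_sum_add[of w "m * n" m] by (simp add: distrib_left add.commute)
qed auto

text \<open>Formally this is the binomial expansion of \<open>w ^ n - 1\<close> in powers of
  \<open>w - 1\<close>, divided by \<open>w - 1\<close>. Since \<open>w - 1\<close> may be a zero
  divisor, the proof is by induction.\<close>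

lemma geometric_sum_binomial:
  "(\<Sum>j<n. w ^ j) = (\<Sum>i<n. of_nat (n choose Suc i) * (w - 1 :: 'r::ring_1) ^ i)"
proof (induction n)
  case (Suc n)
  let ?d = "w - 1"
  have "w ^ n = 1 + (\<Sum>i<n. of_nat (n choose Suc i) * ?d ^ i) * ?d"
    using geometric_sum_mult(2)[of w n] Suc.IH by (simp add: algebra_simps)
  also have "\<dots> = of_nat (n choose 0) * ?d ^ 0 + (\<Sum>i<n. of_nat (n choose Suc i) * ?d ^ Suc i)"
    by (simp add: sum_distrib_right mult.assoc power_commutes del: power_Suc) (simp add: power_commutes mult.assoc)
  also have "\<dots> = (\<Sum>i<Suc n. of_nat (n choose i) * ?d ^ i)"
    by (rule sum.lessThan_Suc_shift[symmetric])
  finally have "(\<Sum>j<Suc n. w ^ j)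
      = (\<Sum>i<Suc n. of_nat (n choose Suc i) * ?d ^ i) + (\<Sum>i<Suc n. of_nat (n choose i) * ?d ^ i)"
    by (simp add: Suc.IH binomial_eq_0)
  also have "\<dots> = (\<Sum>i<Suc n. of_nat (Suc n choose Suc i) * ?d ^ i)"
    by (simp only: sum.distrib[symmetric] distrib_right[symmetric] of_nat_add[symmetric] binomial_Suc_Suc add.commute)
  finally show ?case .
qed auto

text \<open>In the binomial expansion the top coefficient is \<open>1\<close> and all others are
  divisible by the prime \<open>r\<close>.\<close>

lemma geometric_sum_mod_prime:
  assumes "Factorial_Ring.prime r"
  obtains q where "(\<Sum>j<r. w ^ j) = (w - 1) ^ (r - 1) + of_nat r * (q :: 'r::ring_1)"
proof -
  obtain s where r: "r = Suc s"
    using prime_gt_0_nat[OF assms] by (cases r) auto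
  define q where "q = (\<Sum>i<s. of_nat ((r choose Suc i) div r) * (w - 1) ^ i)"
  have "of_nat (r choose Suc i) = of_nat r * (of_nat ((r choose Suc i) div r) :: 'r)" if "i < s" for i
  proof -
    have "r dvd (r choose Suc i)"
      using dvd_choose_prime[of "Suc i" r] assms that r by simp
    then have "r choose Suc i = r * ((r choose Suc i) div r)"
      by simp
    then show ?thesis
      by (metis of_nat_mult)
  qed
  then have "(\<Sum>i<s. of_nat (r choose Suc i) * (w - 1) ^ i) = of_nat r * q"
    by (simp add: q_def sum_distrib_left mult.assoc)
  then have "(\<Sum>j<r. w ^ j) = (w - 1) ^ (r - 1) + of_nat r * q"
    by (simp add: geometric_sum_binomial[of w r]) (simp add: r binomial_eq_0)
  then show thesis
    by (rule that)
qed

section \<open>Norm elements of cyclic subgroups\<close>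

lemma lookup_times_frag_of:
  "Poly_Mapping.lookup (a * frag_of h) y = Poly_Mapping.lookup a (y - h :: 'k::group_add)"
proof (induction a rule: frag_induct)
  case (one x)
  have "y = x + h \<longleftrightarrow> y - h = x"
    by (auto simp: diff_eq_eq)
  then show ?case
    by (simp add: frag_of_mult)
qed (auto simp: left_diff_distrib lookup_minus)

lemma frag_of_power: obtains h where "frag_of (g :: 'k::monoid_add) ^ i = frag_of h"
proof -
  have "\<exists>h. frag_of g ^ i = frag_of h"
  proof (induction i)
    case 0
    show ?case
      by (metis frag_of_zero power_0)
  next
    case (Suc i)
    then show ?case
      by (metis frag_of_mult power_Suc)
  qed
  then show thesis
    using that by blast
qed

lemma frag_of_eq_1_iff: "frag_of g = (1 :: 'k::monoid_add \<Rightarrow>\<^sub>0 int) \<longleftrightarrow> g = 0"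
  unfolding frag_of_zero[symmetric] frag_of_eq by simp

context
  fixes g :: "'k::group_add" and b :: nat
  assumes b_pos: "b > 0" and order: "\<And>i. frag_of g ^ i = 1 \<longleftrightarrow> b dvd i"
begin

lemma frag_of_power_order: "frag_of g ^ b = 1"
  using order[of b] by simp

lemma norm_sum_times: "(\<Sum>i<b. frag_of g ^ i) * frag_of g = (\<Sum>i<b. frag_of g ^ i)"
  "frag_of g * (\<Sum>i<b. frag_of g ^ i) = (\<Sum>i<b. frag_of g ^ i)"
  using geometric_sum_mult[of "frag_of g" b] by (simp_all add: frag_of_power_order algebra_simps)

lemma norm_sum_times_power:
  "(\<Sum>i<b. frag_of g ^ i) * frag_of g ^ j = (\<Sum>i<b. frag_of g ^ i)"
  "frag_of g ^ j * (\<Sum>i<b. frag_of g ^ i) = (\<Sum>i<b. frag_of g ^ i)"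
proof (induction j)
  case (Suc j)
  {
    case 1 then show ?case
      by (simp only: power_Suc mult.assoc[symmetric] norm_sum_times Suc)
  next
    case 2 then show ?case
      by (simp only: power_Suc2 mult.assoc norm_sum_times Suc)
  }
qed auto

lemma tr_frag_of_power: "tr (frag_of g ^ i) = of_bool (b dvd i)"
proof -
  obtain h where "frag_of g ^ i = frag_of h"
    by (rule frag_of_power)
  then show ?thesis
    using order[of i] by (auto simp: frag_of_eq_1_iff)
qed

lemma tr_norm_sum: "tr (\<Sum>i<b. frag_of g ^ i) = 1"
proof -
  have "tr (\<Sum>i<b. frag_of g ^ i) = (\<Sum>i<b. if i = 0 then 1 else 0)"
    unfolding lookup_sum by (intro sum.cong) (auto simp: tr_frag_of_power dest: dvd_imp_le)
  then show ?thesis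
    using b_pos by simp
qed

lemma augmentation_norm_sum: "augmentation (\<Sum>i<b. frag_of g ^ i) = int b"
  by (simp add: augmentation_sum augmentation_power)

text \<open>The coefficients of \<open>a\<close> are constant on the left cosets of the subgroup
  generated by \<open>g\<close>, each of which has \<open>b\<close> elements. The induction removes
  one coset from the support at a time.\<close>

lemma dvd_augmentation_of_invariant:
  assumes "a * frag_of g = a"
  shows "int b dvd augmentation a"
  using assms
proof (induction "card (Poly_Mapping.keys a)" arbitrary: a rule: less_induct)
  case less
  show ?case
  proof (cases "a = 0")
    case False
    then obtain x where x: "x \<in> Poly_Mapping.keys a"
      by fastforce
    define l where "l = Poly_Mapping.lookup a x"
    define a' where "a' = a - of_int l * (frag_of x * (\<Sum>i<b. frag_of g ^ i))"
    have inv: "a * frag_of g ^ i = a" for i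
      by (induction i) (auto simp: power_commutes mult.assoc[symmetric] less.prems)
    have val: "Poly_Mapping.lookup (frag_of x * (\<Sum>i<b. frag_of g ^ i)) y
      = tr (frag_of (- y + x) * (\<Sum>i<b. frag_of g ^ i))" for y
    proof -
      have "tr (frag_of (- y + x) * (\<Sum>i<b. frag_of g ^ i))
        = tr (frag_of (- y) * (frag_of x * (\<Sum>i<b. frag_of g ^ i)))"
        by (simp only: frag_of_mult[symmetric] mult.assoc)
      also have "\<dots> = Poly_Mapping.lookup (frag_of x * (\<Sum>i<b. frag_of g ^ i)) y"
        by (subst tr_commute) (simp add: lookup_times_frag_of)
      finally show ?thesis by simp
    qed
    have "Poly_Mapping.lookup a' x = 0"
      by (simp add: a'_def lookup_minus lookup_of_int_times val tr_norm_sum l_def)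
    moreover have "Poly_Mapping.lookup a' y = 0" if y: "Poly_Mapping.lookup a y = 0" for y
    proof -
      have "Poly_Mapping.lookup (frag_of x * frag_of g ^ i) y = 0" for i
      proof -
        obtain h where h: "frag_of g ^ i = frag_of h"
          by (rule frag_of_power)
        have "Poly_Mapping.lookup a (x + h) = Poly_Mapping.lookup a x"
          using lookup_times_frag_of[of a h "x + h"] inv[of i] h by simp
        then have "y \<noteq> x + h"
          using x y by (auto simp: in_keys_iff)
        then show ?thesis
          by (simp add: h frag_of_mult)
      qed
      then show ?thesis
        using y by (simp add: a'_def lookup_minus lookup_of_int_times sum_distrib_left lookup_sum)
    qed
    ultimately have "Poly_Mapping.keys a' \<subset> Poly_Mapping.keys a"
      using x by (auto simp: in_keys_iff)
    then have "card (Poly_Mapping.keys a') < card (Poly_Mapping.keys a)"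
      by (intro psubset_card_mono) auto
    moreover have "a' * frag_of g = a'"
      by (simp add: a'_def left_diff_distrib mult.assoc norm_sum_times less.prems)
    ultimately have "int b dvd augmentation a'"
      by (rule less.hyps)
    moreover have "augmentation a = augmentation a' + l * int b"
      by (simp add: a'_def augmentation_diff augmentation_times augmentation_norm_sum)
    ultimately show ?thesis
      by simp
  qed auto
qed

end

context finite_subgroup
begin

lemma power_frag_of_mem: "g \<in> H \<Longrightarrow> frag_of g ^ i = frag_of h \<Longrightarrow> h \<in> H"
  by (metis ZH_frag_of ZH_power)

text \<open>The coefficients of \<open>a\<close> sum to zero over each left coset of the subgroup
  generated by \<open>g\<close>. So a coefficient can be moved to another support point of its
  coset, which changes \<open>a\<close> by a left multiple of \<open>frag_of g - 1\<close> and
  shrinks the support.\<close>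

lemma annihilator_norm_sum:
  assumes g: "g \<in> H" and b: "b > 0" and order: "\<And>i. frag_of g ^ i = 1 \<longleftrightarrow> b dvd i"
    and a: "a \<in> ZH" "a * (\<Sum>i<b. frag_of g ^ i) = 0"
  shows "\<exists>Y\<in>ZH. a = Y * (frag_of g - 1)"
  using a
proof (induction "card (Poly_Mapping.keys a)" arbitrary: a rule: less_induct)
  case less
  let ?N = "\<Sum>i<b. frag_of g ^ i"
  show ?case
  proof (cases "a = 0")
    case True
    then show ?thesis
      by (intro bexI[of _ 0]) auto
  next
    case False
    then obtain x where x: "x \<in> Poly_Mapping.keys a"
      by fastforce
    define l where "l = Poly_Mapping.lookup a x"
    have sum0: "(\<Sum>i<b. Poly_Mapping.lookup (a * frag_of g ^ i) x) = 0"
      using arg_cong[OF less.prems(2), of "\<lambda>a. Poly_Mapping.lookup a x"]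
      by (simp add: sum_distrib_left lookup_sum)
    \<comment> \<open>The term \<open>i = 0\<close> is the nonzero coefficient at \<open>x\<close>,
      so a second term must be nonzero for the sum to vanish.\<close>
    have "\<exists>i\<in>{..<b} - {0}. Poly_Mapping.lookup (a * frag_of g ^ i) x \<noteq> 0"
    proof (rule ccontr)
      assume "\<not> ?thesis"
      then have "(\<Sum>i\<in>{..<b} - {0}. Poly_Mapping.lookup (a * frag_of g ^ i) x) = 0"
        by simp
      then have "Poly_Mapping.lookup a x = 0"
        using sum0 b by (subst (asm) sum.remove[of _ 0]) auto
      with x show False
        by (simp add: in_keys_iff)
    qed
    then obtain i where i: "0 < i" "i < b" "Poly_Mapping.lookup (a * frag_of g ^ i) x \<noteq> 0"
      by auto
    obtain h where h: "frag_of g ^ i = frag_of h"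
      by (rule frag_of_power)
    define y where "y = x - h"
    have y: "y \<in> Poly_Mapping.keys a"
      using i(3) by (simp add: h lookup_times_frag_of y_def in_keys_iff)
    have "frag_of g ^ i \<noteq> 1"
      using i order[of i] by (auto dest: dvd_imp_le)
    then have "h \<noteq> 0"
      by (simp add: h frag_of_eq_1_iff)
    then have "y \<noteq> x"
      by (metis y_def add_0_right diff_add_cancel add_left_cancel)
    have xy: "frag_of x = frag_of y * frag_of g ^ i"
      by (simp add: h frag_of_mult y_def)
    have yH: "y \<in> H"
      using y less.prems(1) by (auto simp: ZH_def)
    define a' where "a' = a - of_int l * (frag_of x - frag_of y)"
    have "Poly_Mapping.lookup a' x = 0"
      using \<open>y \<noteq> x\<close> by (simp add: a'_def lookup_minus lookup_of_int_times l_def)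
    moreover have "Poly_Mapping.lookup a' w = 0" if "Poly_Mapping.lookup a w = 0" for w
      using that x y by (auto simp: a'_def lookup_minus lookup_of_int_times in_keys_iff)
    ultimately have "Poly_Mapping.keys a' \<subset> Poly_Mapping.keys a"
      using x by (auto simp: in_keys_iff)
    then have "card (Poly_Mapping.keys a') < card (Poly_Mapping.keys a)"
      by (intro psubset_card_mono) auto
    moreover have "a' \<in> ZH"
    proof -
      have "x \<in> H"
        using less.prems(1) x by (auto simp: ZH_def)
      then show ?thesis
        unfolding a'_def using less.prems(1) yH by (intro ZH_diff ZH_times) auto
    qed
    moreover have "a' * ?N = 0"
      using less.prems(2)
      by (simp add: a'_def xy left_diff_distrib right_diff_distrib mult.assoc norm_sum_times_power[OF b order])
    ultimately obtain Y where Y: "Y \<in> ZH" "a' = Y * (frag_of g - 1)"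
      using less.hyps by blast
    \<comment> \<open>The two points differ by a power of \<open>g\<close>, so their difference is a
      geometric sum times \<open>frag_of g - 1\<close>.\<close>
    have "frag_of x - frag_of y = frag_of y * ((\<Sum>j<i. frag_of g ^ j) * (frag_of g - 1))"
      unfolding geometric_sum_mult xy by (simp add: right_diff_distrib)
    then have "a = (Y + of_int l * (frag_of y * (\<Sum>j<i. frag_of g ^ j))) * (frag_of g - 1)"
      using Y(2) by (simp add: a'_def distrib_right mult.assoc diff_eq_eq)
    moreover have "Y + of_int l * (frag_of y * (\<Sum>j<i. frag_of g ^ j)) \<in> ZH"
      using Y(1) yH g by (intro ZH_add ZH_times ZH_sum ZH_power) auto
    ultimately show ?thesis
      by blast
  qed
qed

end

subsection \<open>Groups with cyclic derived subgroup\<close>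

text \<open>The element \<open>c\<close> has order \<open>n\<close> and every commutator is a power
  of it. This is stated in the group ring, whose multiplicative powers stand for repeated addition
  in the group.\<close>

locale cyclic_by_abelian = finite_subgroup H for H :: "'k::group_add set" +
  fixes c :: 'k and n :: nat
  assumes c_mem: "c \<in> H" and n_pos: "n > 0"
    and order_c: "frag_of c ^ i = 1 \<longleftrightarrow> n dvd i"
    and commute_mod_c: "g \<in> H \<Longrightarrow> h \<in> H \<Longrightarrow> \<exists>k. frag_of g * frag_of h = frag_of h * frag_of g * frag_of c ^ k"
begin

abbreviation C :: "'k \<Rightarrow>\<^sub>0 int"
  where "C \<equiv> frag_of c"

definition N :: "nat \<Rightarrow> 'k \<Rightarrow>\<^sub>0 int"
  where "N d = (\<Sum>i<n div d. (C ^ d) ^ i)"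

lemma C_ZH: "C ^ i \<in> ZH"
  using c_mem by simp

lemma frag_of_inverse: "frag_of (- g) * frag_of g = 1" "frag_of g * frag_of (- g) = 1" for g :: 'k
  by (simp_all add: frag_of_mult)

lemma conj_right: "g \<in> H \<Longrightarrow> \<exists>k. C * frag_of g = frag_of g * C ^ k"
  by (metis commute_mod_c c_mem mult.assoc power_Suc)

lemma conj_left:
  assumes "g \<in> H"
  shows "\<exists>k. frag_of g * C = C ^ k * frag_of g"
proof -
  obtain k where k: "C * frag_of (- g) = frag_of (- g) * C ^ k"
    using conj_right uminus_mem assms by blast
  have "frag_of g * C = frag_of g * (C * frag_of (- g)) * frag_of g"
    by (simp only: mult.assoc frag_of_inverse mult_1_right)
  also have "\<dots> = C ^ k * frag_of g"
    by (simp only: k mult.assoc[symmetric] frag_of_inverse mult_1_left)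
  finally show ?thesis ..
qed

section \<open>The norm elements \<open>N d\<close> for divisors \<open>d\<close> of
  \<open>n\<close>\<close>

context
  fixes d :: nat
  assumes d: "d dvd n"
begin

lemma order_C_power: "(C ^ d) ^ i = 1 \<longleftrightarrow> n div d dvd i"
proof -
  have "d > 0"
    using d n_pos by (auto intro: Nat.gr0I)
  then show ?thesis
    using d by (auto simp: power_mult[symmetric] order_c elim!: dvdE)
qed

lemma quotient_pos: "n div d > 0"
  using d n_pos by (auto simp: div_greater_zero_iff dvd_imp_le intro: Nat.gr0I)

lemma C_power_frag_of:
  obtains g where "g \<in> H" "C ^ d = frag_of g" "\<And>i. frag_of g ^ i = 1 \<longleftrightarrow> n div d dvd i"
    "N d = (\<Sum>i<n div d. frag_of g ^ i)"
proof -
  obtain g where g: "C ^ d = frag_of g"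
    by (rule frag_of_power)
  show thesis
    using that[of g] power_frag_of_mem[OF c_mem g] order_C_power by (simp add: g N_def)
qed

lemma N_ZH [simp]: "N d \<in> ZH"
  unfolding N_def using c_mem by (intro ZH_sum) auto

lemma N_times_power: "N d * (C ^ d) ^ i = N d" "(C ^ d) ^ i * N d = N d"
proof -
  obtain g where g: "C ^ d = frag_of g" "\<And>i. frag_of g ^ i = 1 \<longleftrightarrow> n div d dvd i"
    "N d = (\<Sum>i<n div d. frag_of g ^ i)"
    using C_power_frag_of by metis
  show "N d * (C ^ d) ^ i = N d" "(C ^ d) ^ i * N d = N d"
    unfolding g by (rule norm_sum_times_power[OF quotient_pos g(2)])+
qed

lemma tr_N: "tr (N d) = 1" and augmentation_N: "augmentation (N d) = int (n div d)"
proof -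
  obtain g where g: "\<And>i. frag_of g ^ i = 1 \<longleftrightarrow> n div d dvd i"
    "N d = (\<Sum>i<n div d. frag_of g ^ i)"
    using C_power_frag_of by metis
  show "tr (N d) = 1" "augmentation (N d) = int (n div d)"
    unfolding g(2) using tr_norm_sum[OF quotient_pos g(1)] augmentation_norm_sum[OF quotient_pos g(1)] by simp_all
qed

lemma N_sum_powers: "N d * (\<Sum>i<m. (C ^ d) ^ (k i)) = of_nat m * N d"
  "(\<Sum>i<m. (C ^ d) ^ (k i)) * N d = of_nat m * N d" for k :: "nat \<Rightarrow> nat"
  by (simp_all add: sum_distrib_left sum_distrib_right N_times_power)

lemma N_square: "N d * N d = of_nat (n div d) * N d"
  using N_sum_powers(1)[where m = "n div d" and k = "\<lambda>i. i"] by (simp add: N_def)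

text \<open>Since \<open>star (N d)\<close> absorbs \<open>C ^ d\<close>, the product
  \<open>star (N d) * N d\<close> is \<open>n div d\<close> times \<open>star (N d)\<close>. The
  product is self-adjoint, so the factor can be cancelled.\<close>

lemma star_N: "star (N d) = N d"
proof -
  have inv: "star (C ^ d) * C ^ d = 1"
  proof -
    obtain g where "C ^ d = frag_of g"
      by (rule frag_of_power)
    then show ?thesis
      by (simp add: frag_of_mult)
  qed
  have "star (N d) * star (C ^ d) = star (N d)"
    using N_times_power(2)[of 1] by (metis star_times power_one_right)
  then have "star (N d) * C ^ d = star (N d) * (star (C ^ d) * C ^ d)"
    by (simp only: mult.assoc[symmetric])
  then have 1: "star (N d) * C ^ d = star (N d)"
    by (simp only: inv mult_1_right)
  have "star (N d) * (C ^ d) ^ i = star (N d)" for i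
  proof (induction i)
    case (Suc i)
    then show ?case
      by (simp only: power_Suc mult.assoc[symmetric] 1)
  qed auto
  then have *: "star (N d) * N d = of_nat (n div d) * star (N d)"
    by (subst (2) N_def) (simp add: sum_distrib_left)
  have "of_nat (n div d) * star (N d) = star (star (N d) * N d)"
    by (simp only: star_times star_star) (rule *[symmetric])
  also have "\<dots> = of_nat (n div d) * N d"
    using star_of_int[of "int (n div d)", where 'k = 'k] by (simp add: * star_times of_nat_commute)
  finally show ?thesis
    using of_nat_times_cancel[OF quotient_pos] by blast
qed

text \<open>Conjugation maps powers of \<open>C ^ d\<close> to such powers. Evaluating
  \<open>N d * frag_of g * N d\<close> from either side gives the same multiple of
  \<open>frag_of g * N d\<close> and of \<open>N d * frag_of g\<close>, so it need not be checked
  that conjugation permutes the summands.\<close>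

lemma N_commute:
  assumes "x \<in> ZH"
  shows "N d * x = x * N d"
  using assms
proof (induction x rule: ZH_induct)
  case (one g)
  obtain k where "C * frag_of g = frag_of g * C ^ k"
    using conj_right one by blast
  then have "C ^ (d * i) * frag_of g = frag_of g * (C ^ k) ^ (d * i)" for i
    by (rule power_commutes_twist)
  then have "N d * frag_of g = frag_of g * (\<Sum>i<n div d. (C ^ d) ^ (k * i))"
    by (simp add: N_def sum_distrib_left sum_distrib_right power_mult[symmetric] mult.left_commute[of d])
  then have 1: "N d * frag_of g * N d = of_nat (n div d) * (frag_of g * N d)"
    by (simp only: mult.assoc N_sum_powers) (simp only: mult.assoc[symmetric] of_nat_commute)
  obtain l where "frag_of g * C = C ^ l * frag_of g"
    using conj_left one by blast
  then have "(C ^ l) ^ (d * i) * frag_of g = frag_of g * C ^ (d * i)" for i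
    by (intro power_commutes_twist) simp
  then have "frag_of g * N d = (\<Sum>i<n div d. (C ^ d) ^ (l * i)) * frag_of g"
    by (simp add: N_def sum_distrib_left sum_distrib_right power_mult[symmetric] mult.left_commute[of d])
  then have "N d * frag_of g * N d = of_nat (n div d) * (N d * frag_of g)"
    by (simp only: mult.assoc) (simp only: mult.assoc[symmetric] N_sum_powers)
  with 1 show ?case
    using of_nat_times_cancel[OF quotient_pos] by metis
qed (simp_all add: left_diff_distrib right_diff_distrib)

text \<open>The left ideal generated by \<open>C ^ d - 1\<close> is two-sided: passing a group
  element turns \<open>C ^ d\<close> into a power of itself, and \<open>C ^ d - 1\<close> divides
  that power minus \<open>1\<close>.\<close>

lemma diff_1_twist:
  assumes "Y \<in> ZH"
  shows "\<exists>Y'\<in>ZH. (C ^ d - 1) * Y = Y' * (C ^ d - 1)"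
  using assms
proof (induction Y rule: ZH_induct)
  case zero
  show ?case
    by (intro bexI[of _ 0]) auto
next
  case (one g)
  obtain k where "C * frag_of g = frag_of g * C ^ k"
    using conj_right one by blast
  then have "C ^ d * frag_of g = frag_of g * (C ^ k) ^ d"
    by (rule power_commutes_twist)
  then have "(C ^ d - 1) * frag_of g = frag_of g * ((C ^ d) ^ k - 1)"
    by (simp add: left_diff_distrib right_diff_distrib power_mult[symmetric] mult.commute[of k])
  also have "\<dots> = (frag_of g * (\<Sum>i<k. (C ^ d) ^ i)) * (C ^ d - 1)"
    by (simp only: geometric_sum_mult mult.assoc)
  finally show ?case
    using one c_mem by (intro bexI[of _ "frag_of g * (\<Sum>i<k. (C ^ d) ^ i)"] ZH_times ZH_sum) auto
next
  case (diff a b)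
  then obtain a' b' where "a' \<in> ZH" "b' \<in> ZH"
    "(C ^ d - 1) * a = a' * (C ^ d - 1)" "(C ^ d - 1) * b = b' * (C ^ d - 1)"
    by blast
  then have "(C ^ d - 1) * (a - b) = (a' - b') * (C ^ d - 1)" "a' - b' \<in> ZH"
    by (auto simp only: right_diff_distrib[of _ a] left_diff_distrib[of a'])
  then show ?case
    by blast
qed

end


lemma torsion_times_N:
  assumes "d dvd n" "v \<in> ZH" "v ^ q * N d = N d" "q > 0" "augmentation v = 1" "tr (v * N d) \<noteq> 0"
  shows "v * N d = N d"
  using quotient_pos[OF assms(1)] augmentation_N[OF assms(1)]
  by (intro berman_higman[OF assms(2) N_ZH[OF assms(1)] star_N[OF assms(1)] N_commute[OF assms(1)]
        N_square[OF assms(1)] quotient_pos[OF assms(1)] tr_N[OF assms(1)] assms(3-5) _ assms(6)]) auto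

lemma annihilator_N:
  assumes "d dvd n" "a \<in> ZH" "a * N d = 0"
  shows "\<exists>Y\<in>ZH. a = Y * (C ^ d - 1)"
proof -
  obtain g where g: "g \<in> H" "C ^ d = frag_of g" "\<And>i. frag_of g ^ i = 1 \<longleftrightarrow> n div d dvd i"
    "N d = (\<Sum>i<n div d. frag_of g ^ i)"
    using C_power_frag_of[OF assms(1)] by metis
  have "a * (\<Sum>i<n div d. frag_of g ^ i) = 0"
    using assms(3) by (simp only: g(4))
  from annihilator_norm_sum[OF g(1) quotient_pos[OF assms(1)] g(3) assms(2) this]
  show ?thesis
    by (simp only: g(2))
qed

lemma dvd_augmentation:
  assumes "d dvd n" "a * (C ^ d - 1) = 0"
  shows "int (n div d) dvd augmentation a"
proof -
  obtain g where g: "C ^ d = frag_of g" "\<And>i. frag_of g ^ i = 1 \<longleftrightarrow> n div d dvd i"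
    using C_power_frag_of[OF assms(1)] by metis
  have "a * frag_of g = a"
    using assms(2) by (simp only: g(1) right_diff_distrib) simp
  with quotient_pos[OF assms(1)] g(2) show ?thesis
    by (rule dvd_augmentation_of_invariant)
qed

lemma diff_1_times_N: "d dvd n \<Longrightarrow> (C ^ d - 1) * N d = 0"
  using N_times_power(2)[of d 1] by (simp add: left_diff_distrib)

text \<open>The factors \<open>C ^ d - 1\<close> are collected on the right by
  \<open>diff_1_twist\<close>. The leftmost factor stays \<open>Y\<close>, which preserves
  divisibility of the augmentation.\<close>

lemma diff_1_power:
  assumes d: "d dvd n" and Y: "Y \<in> ZH" "u - 1 = Y * (C ^ d - 1)" "r dvd augmentation Y"
  shows "\<exists>W\<in>ZH. (u - 1) ^ Suc j = W * (C ^ d - 1) ^ Suc j \<and> r dvd augmentation W"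
proof (induction j)
  case 0
  show ?case
    using Y by (intro bexI[of _ Y]) simp_all
next
  case (Suc j)
  then obtain W where W: "W \<in> ZH" "(u - 1) ^ Suc j = W * (C ^ d - 1) ^ Suc j"
    by blast
  obtain W' where W': "W' \<in> ZH" "(C ^ d - 1) * W = W' * (C ^ d - 1)"
    using diff_1_twist[OF d W(1)] by blast
  have "(u - 1) ^ Suc (Suc j) = (u - 1) * (W * (C ^ d - 1) ^ Suc j)"
    by (simp only: power_Suc[of _ "Suc j"] W(2))
  also have "\<dots> = Y * ((C ^ d - 1) * W) * (C ^ d - 1) ^ Suc j"
    by (simp only: Y(2) mult.assoc)
  also have "\<dots> = (Y * W') * (C ^ d - 1) ^ Suc (Suc j)"
    by (simp only: W'(2) power_Suc[of _ "Suc j"] mult.assoc)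
  finally show ?case
    using Y W' by (intro bexI[of _ "Y * W'"]) (auto simp: augmentation_times)
qed

text \<open>One step of the descent from the subgroup generated by \<open>C ^ d\<close> to its
  subgroup of index \<open>r\<close>. If \<open>u\<close> moved \<open>M\<close>, the elements
  \<open>u ^ j * M\<close> would be orthogonal, and two evaluations of \<open>F * M\<close> would
  clash modulo \<open>r\<close>.\<close>

lemma prime_step:
  assumes u: "u \<in> ZH" "u ^ q = 1" "q > 0" "augmentation u = 1"
    and r: "Factorial_Ring.prime r" "d * r dvd n"
    and Y: "Y \<in> ZH" "u - 1 = Y * (C ^ d - 1)" "int r dvd augmentation Y"
  shows "u * N (d * r) = N (d * r)"
proof (rule ccontr)
  define z where "z = C ^ d"
  define M where "M = N (d * r)"
  define b where "b = n div (d * r)"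
  define Q where "Q = (\<Sum>j<r. z ^ j)"
  define F where "F = (\<Sum>j<r. u ^ j)"
  assume "u * N (d * r) \<noteq> N (d * r)"
  then have neq: "u * M \<noteq> M"
    by (simp add: M_def)
  have d: "d dvd n"
    using r(2) by (rule dvd_mult_left)
  have d_pos: "d > 0"
    using d n_pos by (auto intro: Nat.gr0I)
  have r2: "r \<ge> 2"
    using r(1) by (rule prime_ge_2_nat)
  have nd: "n div d = r * b"
    using r(2) d_pos r2 by (auto simp: b_def elim!: dvdE)
  have b_pos: "b > 0"
    unfolding b_def by (rule quotient_pos[OF r(2)])
  have M: "M \<in> ZH" "star M = M" "\<And>x. x \<in> ZH \<Longrightarrow> M * x = x * M" "M * M = of_nat b * M" "tr M = 1"
    "(z ^ r - 1) * M = 0"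
    unfolding M_def b_def z_def power_mult[symmetric]
    by (fact N_ZH[OF r(2)] star_N[OF r(2)] N_commute[OF r(2)] N_square[OF r(2)] tr_N[OF r(2)]
        diff_1_times_N[OF r(2)])+
  have z: "z \<in> ZH"
    using C_ZH by (simp add: z_def)
  have Q_ZH: "Q \<in> ZH"
    unfolding Q_def using z by (intro ZH_sum) auto
  \<comment> \<open>The powers of \<open>z\<close> are split into cosets of the powers of
    \<open>z ^ r\<close>.\<close>
  have Nd: "N d = Q * M"
    unfolding N_def M_def nd b_def[symmetric] Q_def z_def
    by (simp only: geometric_sum_times power_mult)
  have zNd: "(z - 1) * N d = 0"
    using diff_1_times_N[OF d] by (simp only: z_def)
  have uNd: "u * N d = N d"
  proof -
    have "(u - 1) * N d = Y * ((z - 1) * N d)"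
      by (simp only: Y(2) z_def mult.assoc)
    also have "\<dots> = 0"
      by (simp only: zNd mult_zero_right)
    finally show ?thesis
      by (simp add: left_diff_distrib)
  qed
  obtain qu where qu: "F = (u - 1) ^ (r - 1) + of_nat r * qu"
    unfolding F_def by (rule geometric_sum_mod_prime[OF r(1)])
  obtain qz where "Q = (z - 1) ^ (r - 1) + of_nat r * qz"
    unfolding Q_def by (rule geometric_sum_mod_prime[OF r(1)])
  then have qz: "(z - 1) ^ (r - 1) = Q - of_nat r * qz"
    by simp
  have r_Suc: "r = Suc (r - 1)" "r - 1 = Suc (r - 2)"
    using r2 by auto
  \<comment> \<open>Modulo \<open>r\<close>, \<open>u ^ r - 1\<close> is \<open>(u - 1) ^ r\<close>,
    a left multiple of \<open>(z - 1) ^ r\<close> and hence of \<open>z ^ r - 1\<close>, which kills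
    \<open>M\<close>. So \<open>tr (u ^ r * M)\<close> is \<open>1\<close> modulo \<open>r\<close>,
    in particular nonzero, and Berman-Higman applies.\<close>
  have urM: "u ^ r * M = M"
  proof -
    obtain W where W: "(u - 1) ^ r = W * (z - 1) ^ r"
      using diff_1_power[OF d Y, of "r - 1"] r_Suc(1) by (metis z_def)
    have zr: "(z - 1) ^ r = (z ^ r - 1) - of_nat r * ((z - 1) * qz)"
      using geometric_sum_mult(1)[of z r]
      by (subst r_Suc(1)) (simp only: power_Suc qz right_diff_distrib Q_def[symmetric] mult.assoc[symmetric] of_nat_commute)
    have ur: "u ^ r - 1 = (u - 1) ^ r + of_nat r * ((u - 1) * qu)"
      using geometric_sum_mult(1)[of u r] r_Suc(1)
      by (simp only: F_def[symmetric] qu distrib_left) (metis power_Suc mult.assoc of_nat_commute)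
    have "(u ^ r - 1) * M = W * ((z ^ r - 1) * M) + of_nat r * (((u - 1) * qu - W * ((z - 1) * qz)) * M)"
      unfolding ur W zr
      by (simp only: distrib_left distrib_right left_diff_distrib right_diff_distrib
          mult.assoc[symmetric] of_nat_commute[of W]) simp
    then have "u ^ r * M = M + of_nat r * (((u - 1) * qu - W * ((z - 1) * qz)) * M)"
      by (simp add: M(6) left_diff_distrib[of "u ^ r"] diff_eq_eq add.commute)
    then have tr: "tr (u ^ r * M) = 1 + int r * tr (((u - 1) * qu - W * ((z - 1) * qz)) * M)"
      by (simp only: lookup_add lookup_of_nat_times M)
    have "tr (u ^ r * M) \<noteq> 0"
    proof
      assume "tr (u ^ r * M) = 0"
      then have "int r dvd 1"
        unfolding tr by (metis add.commute add_diff_cancel_left' dvd_diff_right_iff dvd_triv_left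
            dvd_0_right dvd_add_right_iff)
      with r2 show False
        by auto
    qed
    moreover have "(u ^ r) ^ q = 1"
      by (metis u(2) power_mult mult.commute power_one)
    ultimately show ?thesis
      unfolding M_def using torsion_times_N[OF r(2), of "u ^ r" q] u
      by (simp add: augmentation_power)
  qed
  have fixed: "u ^ (i * j) * M = M" if "u ^ i * M = M" for i j
  proof (induction j)
    case (Suc j)
    then show ?case
      using that by (simp add: power_add mult.assoc)
  qed auto
  \<comment> \<open>Otherwise Berman-Higman shows that \<open>u ^ j\<close> fixes \<open>M\<close>.
    As \<open>u ^ r\<close> does too and \<open>j\<close> is coprime to \<open>r\<close>, Bezout
    gives that \<open>u\<close> fixes \<open>M\<close>.\<close>
  have tr0: "tr (u ^ j * M) = 0" if j: "0 < j" "j < r" for j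
  proof (rule ccontr)
    assume "tr (u ^ j * M) \<noteq> 0"
    moreover have "(u ^ j) ^ q = 1"
      by (metis u(2) power_mult mult.commute power_one)
    ultimately have ujM: "u ^ j * M = M"
      unfolding M_def using torsion_times_N[OF r(2), of "u ^ j" q] u
      by (simp add: augmentation_power)
    have "coprime j r"
      using r(1) j by (metis coprime_commute prime_imp_coprime nat_dvd_not_less)
    then obtain x y where "j * x = r * y + 1"
      using bezout_nat[of j r] j by auto
    then have "u ^ (j * x) * M = u * (u ^ (r * y) * M)"
      by (simp add: mult.assoc power_add power_commutes)
    with fixed[OF ujM] fixed[OF urM] neq show False
      by simp
  qed
  obtain form m where "invariant_form H u M form m"
    using ex_invariant_form[OF u(1) M(1-3), of q] u by auto
  then interpret invariant_form H u M form m .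
  note form_M = form_central[OF M(3) M(2)]
  have uM: "u * M * u ^ i = u ^ Suc i * M" for i
    using M(3)[of "u ^ i"] u(1) by (simp add: mult.assoc)
  have MN: "M * (x * M) = of_nat b * (x * M)" if "x \<in> ZH" for x
    using M(3)[OF that] M(4) by (metis mult.assoc of_nat_commute)
  \<comment> \<open>Invariance reduces to \<open>i = 0\<close>, where one argument is the central
    element \<open>M\<close> and the form is a trace.\<close>
  have shift: "form (u ^ i * M) (u ^ (i + k) * M) = m * int b * tr (u ^ k * M)" for i k
  proof (induction i)
    case 0
    show ?case
      using MN[of "u ^ k"] u(1) by (simp add: form_M lookup_of_nat_times)
  next
    case (Suc i)
    have "form (u ^ Suc i * M) (u ^ (Suc i + k) * M) = form (M * u ^ i) (M * u ^ (i + k))"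
      using form_invariant[of "u ^ i" "u ^ (i + k)"] by (simp only: uM add_Suc)
    then show ?case
      using Suc M(3) u(1) by simp
  qed
  have orth: "form (u ^ i * M) (u ^ j * M) = (if i = j then m * int b else 0)" if "i < r" "j < r" for i j
  proof (cases i j rule: linorder_cases)
    case less
    then show ?thesis
      using shift[of i "j - i"] tr0[of "j - i"] that by simp
  next
    case equal
    then show ?thesis
      using shift[of i 0] M(5) by simp
  next
    case greater
    then show ?thesis
      using shift[of j "i - j"] tr0[of "i - j"] that form_commute by simp
  qed
  have tr_Nd: "tr (N d) = 1"
    by (rule tr_N[OF d])
  \<comment> \<open>Since \<open>u\<close> fixes \<open>N d\<close>, invariance again reduces to
    pairing with \<open>M\<close>.\<close>
  have cross: "form (u ^ i * M) (N d) = m * int b" for i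
  proof (induction i)
    case 0
    show ?case
      using MN[OF Q_ZH] by (simp add: form_M lookup_of_nat_times tr_Nd flip: Nd)
  next
    case (Suc i)
    have "u * M * Q = N d"
      using M(3)[OF Q_ZH] uNd by (simp only: Nd mult.assoc)
    then have "form (u ^ Suc i * M) (N d) = form (M * u ^ i) (M * Q)"
      using form_invariant[of "u ^ i" Q] by (simp only: uM)
    then show ?case
      using Suc M(3) u(1) Q_ZH by (simp add: Nd)
  qed
  have self: "form (N d) (N d) = m * int (r * b)"
    by (simp only: form_central[OF N_commute[OF d] star_N[OF d]] N_square[OF d] lookup_of_nat_times
        tr_Nd nd mult_1_right)
  have FM: "F * M = (\<Sum>i<r. u ^ i * M)"
    by (simp add: F_def sum_distrib_right)
  have "form (F * M) (F * M) = (\<Sum>i<r. \<Sum>j<r. if i = j then m * int b else 0)"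
    unfolding FM form_sum form_sum_right by (intro sum.cong) (auto simp: orth)
  also have "\<dots> = int r * (m * int b)"
    by simp
  finally have FF: "form (F * M) (F * M) = int r * (m * int b)" .
  have FN: "form (F * M) (N d) = int r * (m * int b)"
    unfolding FM form_sum cross by simp
  \<comment> \<open>The square lengths of \<open>F * M\<close> and \<open>N d\<close> and their
    pairing all equal \<open>m * r * b\<close>.\<close>
  have "form (F * M - N d) (F * M - N d) = 0"
    by (simp add: form_diff form_diff_right FF FN form_commute[of "N d" "F * M"] self)
  then have FMN: "F * M = N d"
    using form_eq_0 by force
  obtain W where W: "W \<in> ZH" "(u - 1) ^ (r - 1) = W * (z - 1) ^ (r - 1)" "int r dvd augmentation W"
    using diff_1_power[OF d Y, of "r - 2"] r_Suc(2) by (metis z_def)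
  \<comment> \<open>\<open>T\<close> collects the errors from replacing \<open>F\<close> and
    \<open>Q\<close> by powers of \<open>u - 1\<close> and \<open>z - 1\<close> modulo
    \<open>r\<close>.\<close>
  define T where "T = (W * qz - qu) * M"
  have "F * M = W * (Q - of_nat r * qz) * M + of_nat r * qu * M"
    by (simp only: qu W(2) qz distrib_right)
  also have "\<dots> = W * (Q * M) - of_nat r * T"
    unfolding T_def
    by (simp only: distrib_left distrib_right left_diff_distrib right_diff_distrib
        mult.assoc[symmetric] of_nat_commute[of W]) simp
  finally have NW: "N d = W * N d - of_nat r * T"
    by (simp only: FMN Nd)
  then have rT: "of_nat r * T = (W - 1) * N d"
    by (simp add: left_diff_distrib algebra_simps)
  have "N d * (z - 1) = 0"
    using N_commute[OF d, of "z - 1"] z zNd by simp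
  \<comment> \<open>\<open>T\<close> is invariant under \<open>z\<close>, so \<open>r * b\<close>
    divides its augmentation. Comparing augmentations in \<open>NW\<close> then gives that
    \<open>augmentation W\<close> is \<open>1\<close> modulo \<open>r\<close>, although
    \<open>r\<close> divides it.\<close>
  then have "of_nat r * (T * (z - 1)) = 0"
    by (simp only: mult.assoc[symmetric] rT) (simp only: mult.assoc mult_zero_right)
  then have "T * (z - 1) = 0"
    using r2 by simp
  then have "int (r * b) dvd augmentation T"
    using dvd_augmentation[OF d, of T] by (simp add: nd z_def)
  then obtain k where k: "augmentation T = int (r * b) * k"
    by (auto elim: dvdE)
  have "int (r * b) = augmentation W * int (r * b) - int r * augmentation T"
    using arg_cong[OF NW, of augmentation]
    by (simp add: augmentation_diff augmentation_times augmentation_N[OF d] nd)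
  then have "int (r * b) * 1 = int (r * b) * (augmentation W - int r * k)"
    by (simp add: k algebra_simps)
  then have "1 = augmentation W - int r * k"
    using r2 b_pos by (simp only: mult_cancel_left) simp
  then have "int r dvd 1"
    using W(3) by (metis dvd_diff dvd_triv_left)
  with r2 show False
    by simp
qed

text \<open>The kernel is trivial. For the largest divisor \<open>d\<close> of \<open>n\<close> such
  that \<open>u\<close> fixes \<open>N d\<close>, a prime factor of \<open>n div d\<close> would
  allow a further \<open>prime_step\<close>; so \<open>d = n\<close> and
  \<open>N d = 1\<close>.\<close>

lemma torsion_congruent_1:
  assumes u: "u \<in> ZH" "u ^ q = 1" "q > 0" "augmentation u = 1"
    and x: "x \<in> ZH" "u - 1 = x * (C - 1)" "int n dvd augmentation x"
  shows "u = 1"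
proof -
  define D where "D = {d. d dvd n \<and> u * N d = N d}"
  have "finite D"
    using n_pos by (simp add: D_def)
  have "(u - 1) * N 1 = x * ((C ^ 1 - 1) * N 1)"
    by (simp only: x(2) power_one_right mult.assoc)
  then have "1 \<in> D"
    using diff_1_times_N[of 1] by (simp add: D_def left_diff_distrib)
  define d where "d = Max D"
  have "d \<in> D"
    using \<open>finite D\<close> \<open>1 \<in> D\<close> by (auto simp: d_def intro: Max_in)
  then have d: "d dvd n" "u * N d = N d"
    by (auto simp: D_def)
  have d_pos: "d > 0"
    using d n_pos by (auto intro: Nat.gr0I)
  have "n div d = 1"
  proof (rule ccontr)
    assume "n div d \<noteq> 1"
    then obtain r where r: "Factorial_Ring.prime r" "r dvd n div d"
      using prime_factor_nat by blast
    then have dr: "d * r dvd n"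
      using d(1) d_pos by (simp add: dvd_div_iff_mult mult.commute)
    have "(u - 1) * N d = 0"
      using d(2) by (simp add: left_diff_distrib)
    then obtain Y where Y: "Y \<in> ZH" "u - 1 = Y * (C ^ d - 1)"
      using annihilator_N[OF d(1), of "u - 1"] u by auto
    \<comment> \<open>Two factorisations of \<open>u - 1\<close> are compared: the cofactors of
      \<open>C - 1\<close> differ by an element that \<open>C\<close> fixes, whose augmentation is a
      multiple of \<open>n\<close>. This carries divisibility from \<open>x\<close> over to
      \<open>Y\<close>.\<close>
    have "x * (C - 1) = Y * ((\<Sum>i<d. C ^ i) * (C - 1))"
      using x(2) Y(2) by (simp only: geometric_sum_mult)
    then have "(x - Y * (\<Sum>i<d. C ^ i)) * (C ^ 1 - 1) = 0"
      by (simp only: left_diff_distrib[of x] mult.assoc power_one_right diff_self)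
    then have "int n dvd augmentation x - augmentation Y * int d"
      using dvd_augmentation[of 1 "x - Y * (\<Sum>i<d. C ^ i)"]
      by (simp add: augmentation_diff augmentation_times augmentation_sum augmentation_power)
    then have "int n dvd augmentation Y * int d"
      using x(3) dvd_diff_right_iff by blast
    moreover have "int (d * r) dvd int n"
      using dr by (simp only: of_nat_dvd_iff)
    ultimately have "int d * int r dvd int d * augmentation Y"
      by (metis dvd_trans mult.commute of_nat_mult)
    then have "int r dvd augmentation Y"
      using d_pos by simp
    then have "d * r \<in> D"
      using prime_step[OF u r(1) dr Y] dr by (simp add: D_def)
    then have "d * r \<le> d"
      using \<open>finite D\<close> by (simp add: d_def)
    with d_pos prime_ge_2_nat[OF r(1)] show False
      by simp
  qed
  then show ?thesis
    using d(2) by (simp add: N_def)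
qed

end

subsection \<open>Congruence to group elements\<close>

context cyclic_by_abelian
begin

text \<open>Whitcomb's congruence. The ideal generated by \<open>C - 1\<close> alone sees only the
  coset of \<open>g\<close> modulo \<open>c\<close>; the condition on the augmentation singles out
  \<open>g\<close> within it.\<close>

definition congruent_to :: "('k \<Rightarrow>\<^sub>0 int) \<Rightarrow> 'k \<Rightarrow> bool"
  where "congruent_to u g \<longleftrightarrow>
    g \<in> H \<and> (\<exists>x\<in>ZH. u - frag_of g = x * (C - 1) \<and> int n dvd augmentation x)"

definition normalized_torsion :: "('k \<Rightarrow>\<^sub>0 int) set"
  where "normalized_torsion = {u \<in> ZH. augmentation u = 1 \<and> (\<exists>q>0. u ^ q = 1)}"

lemma congruent_to_mult:
  assumes u: "u \<in> ZH" "congruent_to u g" and v: "v \<in> ZH" "congruent_to v h"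
  shows "congruent_to (u * v) (g + h)"
proof -
  obtain x y where g: "g \<in> H" and x: "x \<in> ZH" "u - frag_of g = x * (C - 1)" "int n dvd augmentation x"
    and h: "h \<in> H" and y: "y \<in> ZH" "v - frag_of h = y * (C - 1)" "int n dvd augmentation y"
    using assms unfolding congruent_to_def by blast
  obtain w where w: "w \<in> ZH" "(C - 1) * frag_of h = w * (C - 1)"
    using diff_1_twist[of 1 "frag_of h"] h by auto
  have "u * v - frag_of (g + h) = u * (v - frag_of h) + (u - frag_of g) * frag_of h"
    by (simp add: algebra_simps frag_of_mult)
  also have "\<dots> = u * y * (C - 1) + x * ((C - 1) * frag_of h)"
    by (simp only: x y mult.assoc)
  also have "\<dots> = (u * y + x * w) * (C - 1)"
    by (simp only: w mult.assoc distrib_right)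
  finally have "u * v - frag_of (g + h) = (u * y + x * w) * (C - 1)" .
  moreover have "u * y + x * w \<in> ZH"
    using u x y w by auto
  moreover have "int n dvd augmentation (u * y + x * w)"
    using x(3) y(3) by (simp add: augmentation_add augmentation_times)
  ultimately show ?thesis
    using g h add_mem unfolding congruent_to_def by blast
qed

lemma frag_of_finite_order:
  assumes "g \<in> H"
  shows "\<exists>q>0. frag_of g ^ q = 1"
proof -
  have sub: "range (\<lambda>i. frag_of g ^ i) \<subseteq> frag_of ` H"
  proof
    fix a assume "a \<in> range (\<lambda>i. frag_of g ^ i)"
    then obtain i where a: "a = frag_of g ^ i"
      by blast
    obtain h where "frag_of g ^ i = frag_of h"
      by (rule frag_of_power)
    with a power_frag_of_mem[OF assms this] show "a \<in> frag_of ` H"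
      by auto
  qed
  then have "finite (range (\<lambda>i. frag_of g ^ i))"
    using finite_H finite_subset by blast
  then have "\<not> inj (\<lambda>i. frag_of g ^ i)"
    using finite_imageD by blast
  then obtain i j where ij: "i < j" "frag_of g ^ i = frag_of g ^ j"
    by (metis injI linorder_neqE_nat)
  obtain h where h: "frag_of g ^ i = frag_of h"
    by (rule frag_of_power)
  have "frag_of g ^ (j - i) = frag_of (- h) * frag_of h * frag_of g ^ (j - i)"
    by (simp only: frag_of_inverse mult_1_left)
  also have "\<dots> = frag_of (- h) * (frag_of g ^ i * frag_of g ^ (j - i))"
    by (simp only: h mult.assoc)
  also have "frag_of g ^ i * frag_of g ^ (j - i) = frag_of h"
    using ij h by (metis le_add_diff_inverse less_imp_le power_add)
  also have "frag_of (- h) * frag_of h = 1"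
    by (rule frag_of_inverse)
  finally show ?thesis
    using ij by (intro exI[of _ "j - i"]) simp
qed

text \<open>The element \<open>- h + g\<close> has finite order and is congruent to the identity, so
  \<open>torsion_congruent_1\<close> applies to it.\<close>

lemma congruent_to_unique:
  assumes "congruent_to u g" "congruent_to u h"
  shows "g = h"
proof -
  obtain x y where g: "g \<in> H" and x: "x \<in> ZH" "u - frag_of g = x * (C - 1)" "int n dvd augmentation x"
    and h: "h \<in> H" and y: "y \<in> ZH" "u - frag_of h = y * (C - 1)" "int n dvd augmentation y"
    using assms unfolding congruent_to_def by blast
  have mem: "- h + g \<in> H"
    using g h by (intro add_mem uminus_mem)
  then obtain q where q: "q > 0" "frag_of (- h + g) ^ q = 1"
    using frag_of_finite_order by blast
  have "frag_of (- h + g) - 1 = frag_of (- h) * ((u - frag_of h) - (u - frag_of g))"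
    by (simp add: right_diff_distrib frag_of_mult)
  also have "\<dots> = frag_of (- h) * (y - x) * (C - 1)"
    by (simp only: x y mult.assoc left_diff_distrib)
  finally have eq: "frag_of (- h + g) - 1 = frag_of (- h) * (y - x) * (C - 1)" .
  have "int n dvd augmentation (frag_of (- h) * (y - x))"
    unfolding augmentation_times augmentation_diff by (intro dvd_mult dvd_diff x y)
  moreover have "frag_of (- h) * (y - x) \<in> ZH"
    using x(1) y(1) h uminus_mem by (intro ZH_times ZH_diff) simp_all
  ultimately have "frag_of (- h + g) = 1"
    using torsion_congruent_1[of "frag_of (- h + g)" q, OF _ q(2,1) _ _ eq] mem by simp
  then have "- h + g = 0"
    by (simp only: frag_of_eq_1_iff)
  then show ?thesis
    by (metis neg_eq_iff_add_eq_0 add.inverse_inverse)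
qed

text \<open>\<open>N 1\<close> absorbs powers of \<open>c\<close> and hence commutators: multiples
  of \<open>N 1\<close> behave like the group ring of the abelian quotient.\<close>

lemma commute_mod_N:
  assumes "x \<in> ZH" "y \<in> ZH"
  shows "x * y * N 1 = y * x * N 1"
proof -
  have 1: "frag_of g * y * N 1 = y * frag_of g * N 1" if g: "g \<in> H" for g
    using assms(2)
  proof (induction y rule: ZH_induct)
    case (one h)
    obtain k where "frag_of g * frag_of h = frag_of h * frag_of g * C ^ k"
      using commute_mod_c[OF g one] by blast
    then show ?case
      using N_times_power(2)[of 1 k] by (simp only: power_one_right mult.assoc one_dvd)
  qed (simp_all only: left_diff_distrib right_diff_distrib mult_zero_left mult_zero_right)
  show ?thesis
    using assms(1)
  proof (induction x rule: ZH_induct)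
    case (one g)
    then show ?case
      by (rule 1)
  qed (simp_all only: left_diff_distrib right_diff_distrib mult_zero_left mult_zero_right)
qed

lemma mult_power_mod_N:
  assumes "x \<in> ZH" "y \<in> ZH"
  shows "(x * y) ^ i * N 1 = x ^ i * y ^ i * N 1"
proof (induction i)
  case (Suc i)
  have "(x * y) ^ Suc i * N 1 = x * y * (x ^ i * y ^ i * N 1)"
    by (simp only: power_Suc mult.assoc Suc)
  also have "\<dots> = x * (y * (x ^ i * y ^ i) * N 1)"
    by (simp only: mult.assoc)
  also have "y * (x ^ i * y ^ i) * N 1 = (x ^ i * y ^ i) * y * N 1"
    using assms by (intro commute_mod_N) auto
  also have "x * ((x ^ i * y ^ i) * y * N 1) = x ^ Suc i * y ^ Suc i * N 1"
    by (simp only: power_Suc[of x] power_Suc2[of y] mult.assoc)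
  finally show ?case .
qed auto

lemma ex_congruent_to:
  assumes "u \<in> normalized_torsion"
  shows "\<exists>g. congruent_to u g"
proof -
  obtain q where u: "u \<in> ZH" "augmentation u = 1" and q: "q > 0" "u ^ q = 1"
    using assms by (auto simp: normalized_torsion_def)
  have "augmentation (u * N 1) \<noteq> 0"
    using u n_pos by (simp add: augmentation_times augmentation_N)
  then have "u * N 1 \<noteq> 0"
    by (metis augmentation_zero)
  then obtain g where g: "g \<in> Poly_Mapping.keys (u * N 1)"
    by fastforce
  have gH: "g \<in> H"
    using g ZH_times[OF u(1) N_ZH[of 1]] by (auto simp: ZH_def)
  \<comment> \<open>Dividing by a support point \<open>g\<close> of \<open>u * N 1\<close> makes the
    trace of \<open>v * N 1\<close> nonzero. Only \<open>v * N 1\<close> is shown to be periodic,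
    which suffices for the relative Berman-Higman theorem.\<close>
  define v where "v = frag_of (- g) * u"
  obtain q' where q': "q' > 0" "frag_of (- g) ^ q' = 1"
    using frag_of_finite_order uminus_mem[OF gH] by blast
  have "v ^ (q * q') * N 1 = frag_of (- g) ^ (q * q') * u ^ (q * q') * N 1"
    unfolding v_def using gH uminus_mem u by (intro mult_power_mod_N) auto
  also have "frag_of (- g) ^ (q * q') = 1"
    by (metis q'(2) mult.commute power_mult power_one)
  also have "u ^ (q * q') = 1"
    by (simp only: power_mult q(2) power_one)
  finally have vq: "v ^ (q * q') * N 1 = N 1"
    by simp
  have "tr (v * N 1) = Poly_Mapping.lookup (u * N 1) g"
    unfolding v_def mult.assoc by (subst tr_commute) (simp only: lookup_times_frag_of, simp)
  then have "tr (v * N 1) \<noteq> 0"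
    using g by (simp add: in_keys_iff)
  then have "v * N 1 = N 1"
    using vq q q' u gH uminus_mem
    by (intro torsion_times_N[of 1 v "q * q'"]) (auto simp: v_def augmentation_times)
  then have "frag_of g * (frag_of (- g) * (u * N 1)) = frag_of g * N 1"
    by (simp only: v_def mult.assoc)
  then have "u * N 1 = frag_of g * N 1"
    by (simp only: mult.assoc[symmetric] frag_of_inverse mult_1_left)
  then have "(u - frag_of g) * N 1 = 0"
    by (simp only: left_diff_distrib diff_self)
  then obtain y where y: "y \<in> ZH" "u - frag_of g = y * (C - 1)"
    using annihilator_N[of 1 "u - frag_of g"] u gH by auto
  \<comment> \<open>Replacing \<open>g\<close> by its product with \<open>C ^ s\<close> lowers the
    augmentation of the cofactor by \<open>s\<close>, making it divisible by
    \<open>n\<close>.\<close>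
  define s where "s = nat (augmentation y mod int n)"
  have s: "int s = augmentation y mod int n"
    using n_pos by (simp add: s_def)
  obtain h where h: "C ^ s = frag_of h"
    by (rule frag_of_power)
  have "u - frag_of (g + h) = (u - frag_of g) - frag_of g * (C ^ s - 1)"
    by (simp add: h right_diff_distrib frag_of_mult)
  also have "C ^ s - 1 = (\<Sum>i<s. C ^ i) * (C - 1)"
    by (simp only: geometric_sum_mult)
  also have "u - frag_of g - frag_of g * ((\<Sum>i<s. C ^ i) * (C - 1)) = (y - frag_of g * (\<Sum>i<s. C ^ i)) * (C - 1)"
    by (simp only: y left_diff_distrib mult.assoc)
  finally have "u - frag_of (g + h) = (y - frag_of g * (\<Sum>i<s. C ^ i)) * (C - 1)" .
  moreover have "y - frag_of g * (\<Sum>i<s. C ^ i) \<in> ZH"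
    using y gH C_ZH by (intro ZH_diff ZH_times ZH_sum) auto
  moreover have "int n dvd augmentation (y - frag_of g * (\<Sum>i<s. C ^ i))"
    by (simp add: augmentation_diff augmentation_times augmentation_sum augmentation_power s)
  ultimately have "congruent_to u (g + h)"
    unfolding congruent_to_def using gH power_frag_of_mem[OF c_mem h] add_mem by blast
  then show ?thesis ..
qed

text \<open>Uniqueness of the congruence makes the chosen map multiplicative. The product is assumed
  to be torsion, since torsion units need not be closed under multiplication.\<close>

lemma ex_group_element_map:
  "\<exists>f. (\<forall>u\<in>normalized_torsion. f u \<in> H \<and> (f u = 0 \<longrightarrow> u = 1)) \<and>
    (\<forall>u\<in>normalized_torsion. \<forall>v\<in>normalized_torsion.
      u * v \<in> normalized_torsion \<longrightarrow> f (u * v) = f u + f v)"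
proof -
  define f where "f = (\<lambda>u. SOME g. congruent_to u g)"
  have f: "congruent_to u (f u)" if "u \<in> normalized_torsion" for u
    unfolding f_def using ex_congruent_to[OF that] by (rule someI_ex)
  have "u = 1" if u: "u \<in> normalized_torsion" "f u = 0" for u
  proof -
    obtain x where "x \<in> ZH" "u - 1 = x * (C - 1)" "int n dvd augmentation x"
      using f[OF u(1)] u(2) by (auto simp: congruent_to_def)
    then show ?thesis
      using torsion_congruent_1[of u _ x] u(1) by (auto simp: normalized_torsion_def)
  qed
  moreover have "f (u * v) = f u + f v"
    if "u \<in> normalized_torsion" "v \<in> normalized_torsion" "u * v \<in> normalized_torsion" for u v
    using congruent_to_unique[OF f[OF that(3)]] congruent_to_mult[of u "f u" v "f v"] f that
    by (auto simp: normalized_torsion_def)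
  ultimately show ?thesis
    using f by (intro exI[of _ f]) (auto simp: congruent_to_def)
qed

end

subsection \<open>Transfer to the integral group ring of an abstract group\<close>

text \<open>Cayley's theorem puts the abstract group inside a type of class \<^class>\<open>group_add\<close>.\<close>

typedef 'a bijection = "{f :: 'a \<Rightarrow> 'a. bij f}"
  morphisms apply_bijection Bijection
  using bij_id by blast

setup_lifting type_definition_bijection

instantiation bijection :: (type) group_add
begin

lift_definition zero_bijection :: "'a bijection" is id
  by (rule bij_id)

lift_definition plus_bijection :: "'a bijection \<Rightarrow> 'a bijection \<Rightarrow> 'a bijection" is "(\<circ>)"
  by (rule bij_comp)

lift_definition uminus_bijection :: "'a bijection \<Rightarrow> 'a bijection" is "inv_into UNIV"
  by (rule bij_imp_bij_inv)

definition minus_bijection :: "'a bijection \<Rightarrow> 'a bijection \<Rightarrow> 'a bijection"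
  where "minus_bijection f g = f + - g"

instance
proof
  fix f g h :: "'a bijection"
  show "f + g + h = f + (g + h)" "0 + f = f" "f + 0 = f"
    by (transfer, simp add: comp_assoc)+
  show "- f + f = 0"
    by transfer (simp add: bij_is_inj)
  show "f + - g = f - g"
    by (simp add: minus_bijection_def)
qed

end

section \<open>The Cayley embedding and its extension to group rings\<close>

context group
begin

text \<open>Left translation, extended by the identity outside the carrier to give a bijection of
  the whole type.\<close>

definition cayley :: "'a \<Rightarrow> 'a bijection"
  where "cayley g = Bijection (\<lambda>x. if x \<in> carrier G then g \<otimes> x else x)"

lemma apply_cayley:
  assumes "g \<in> carrier G"
  shows "apply_bijection (cayley g) = (\<lambda>x. if x \<in> carrier G then g \<otimes> x else x)"
proof -
  have "bij (\<lambda>x. if x \<in> carrier G then g \<otimes> x else x)"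
    by (rule bij_betw_byWitness[where f' = "\<lambda>x. if x \<in> carrier G then inv g \<otimes> x else x"])
      (use assms in \<open>auto simp: m_assoc[symmetric]\<close>)
  then show ?thesis
    by (simp add: cayley_def Bijection_inverse)
qed

lemma cayley_mult:
  assumes "g \<in> carrier G" "h \<in> carrier G"
  shows "cayley (g \<otimes> h) = cayley g + cayley h"
  using assms by (auto simp: apply_bijection_inject[symmetric] plus_bijection.rep_eq apply_cayley m_assoc)

lemma cayley_one: "cayley \<one> = 0"
  by (auto simp: apply_bijection_inject[symmetric] zero_bijection.rep_eq apply_cayley)

lemma inj_on_cayley: "inj_on cayley (carrier G)"
proof (rule inj_onI)
  fix g h assume g: "g \<in> carrier G" and h: "h \<in> carrier G" and "cayley g = cayley h"
  then have "apply_bijection (cayley g) \<one> = apply_bijection (cayley h) \<one>"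
    by simp
  then show "g = h"
    using g h by (simp add: apply_cayley)
qed

lemma cayley_uminus: "g \<in> carrier G \<Longrightarrow> - cayley g = cayley (inv g)"
  by (metis cayley_mult cayley_one inv_closed l_inv neg_eq_iff_add_eq_0 r_inv)

lemma frag_of_cayley_power: "g \<in> carrier G \<Longrightarrow> frag_of (cayley g) ^ i = frag_of (cayley (g [^] i))"
  by (induction i) (simp_all only: power_0 nat_pow_0 cayley_one frag_of_zero power_Suc2 nat_pow_Suc
      cayley_mult nat_pow_closed frag_of_mult)

definition cayley_ring :: "('a \<Rightarrow>\<^sub>0 int) \<Rightarrow> 'a bijection \<Rightarrow>\<^sub>0 int"
  where "cayley_ring = frag_extend (\<lambda>g. frag_of (cayley g))"

lemma cayley_ring_frag_of: "cayley_ring (frag_of g) = frag_of (cayley g)"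
  by (simp only: cayley_ring_def frag_extend_of)

lemma cayley_ring_diff: "cayley_ring (a - b) = cayley_ring a - cayley_ring b"
  by (simp only: cayley_ring_def frag_extend_diff)

lemma cayley_ring_0: "cayley_ring 0 = 0"
  by (simp only: cayley_ring_def frag_extend_0)

lemma cayley_ring_mult:
  assumes "a \<in> carrier (integral_group_ring G)" "b \<in> carrier (integral_group_ring G)"
  shows "cayley_ring (a \<otimes>\<^bsub>integral_group_ring G\<^esub> b) = cayley_ring a * cayley_ring b"
proof -
  have a: "Poly_Mapping.keys a \<subseteq> carrier G" and b: "Poly_Mapping.keys b \<subseteq> carrier G"
    using assms by (auto simp: integral_group_ring_simps)
  have 1: "cayley_ring (frag_of g \<otimes>\<^bsub>integral_group_ring G\<^esub> b) = frag_of (cayley g) * cayley_ring b"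
    if g: "g \<in> carrier G" for g
    using b
  proof (induction b rule: frag_induction)
    case (one h)
    then show ?case
      by (simp only: integral_group_ring_simps frag_extend_of cayley_ring_frag_of cayley_mult[OF g]
          frag_of_mult)
  next
    case (diff b c)
    then show ?case
      by (simp only: integral_group_ring_simps frag_extend_of frag_extend_diff cayley_ring_diff
          right_diff_distrib)
  qed (simp only: integral_group_ring_simps frag_extend_of frag_extend_0 cayley_ring_0 mult_zero_right)
  show ?thesis
    using a
  proof (induction a rule: frag_induction)
    case (one g)
    then show ?case
      by (simp only: 1 cayley_ring_frag_of)
  next
    case (diff a c)
    then show ?case
      by (simp only: integral_group_ring_simps frag_extend_diff cayley_ring_diff left_diff_distrib)
  qed (simp only: integral_group_ring_simps frag_extend_0 cayley_ring_0 mult_zero_left)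
qed

lemma augmentation_cayley_ring: "augmentation (cayley_ring a) = augmentation a"
  by (induction a rule: frag_induct)
    (simp_all only: cayley_ring_0 augmentation_zero cayley_ring_frag_of augmentation_frag_of
      cayley_ring_diff augmentation_diff)

lemma keys_cayley_ring:
  "a \<in> carrier (integral_group_ring G) \<Longrightarrow> Poly_Mapping.keys (cayley_ring a) \<subseteq> cayley ` carrier G"
  using keys_frag_extend[of "\<lambda>g. frag_of (cayley g)" a]
  by (fastforce simp: cayley_ring_def integral_group_ring_simps)

lemma inj_on_cayley_ring: "inj_on cayley_ring (carrier (integral_group_ring G))"
proof (rule inj_onI)
  have lookup: "Poly_Mapping.lookup (cayley_ring a) (cayley g) = Poly_Mapping.lookup a g"
    if a: "a \<in> carrier (integral_group_ring G)" and g: "g \<in> carrier G" for a g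
  proof -
    have "Poly_Mapping.keys a \<subseteq> carrier G"
      using a by (simp add: integral_group_ring_simps)
    then show ?thesis
    proof (induction a rule: frag_induction)
      case (one h)
      then show ?case
        using g inj_on_cayley by (auto simp: cayley_ring_frag_of inj_on_eq_iff)
    qed (simp_all only: cayley_ring_0 lookup_zero cayley_ring_diff lookup_minus)
  qed
  fix a b assume a: "a \<in> carrier (integral_group_ring G)" and b: "b \<in> carrier (integral_group_ring G)"
    and eq: "cayley_ring a = cayley_ring b"
  show "a = b"
  proof (rule poly_mapping_eqI)
    fix g
    show "Poly_Mapping.lookup a g = Poly_Mapping.lookup b g"
    proof (cases "g \<in> carrier G")
      case True
      then show ?thesis
        using lookup[OF a True] lookup[OF b True] eq by simp
    next
      case False
      then have "g \<notin> Poly_Mapping.keys a" "g \<notin> Poly_Mapping.keys b"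
        using a b by (auto simp: integral_group_ring_simps)
      then show ?thesis
        by (simp add: in_keys_iff)
    qed
  qed
qed

lemma cyclic_by_abelian_cayley:
  assumes fin: "finite (carrier G)" and cyc: "cyclic_group (G\<lparr>carrier := derived G (carrier G)\<rparr>)"
  shows "\<exists>c n. cyclic_by_abelian (cayley ` carrier G) c n"
proof -
  let ?D = "derived G (carrier G)"
  have D: "subgroup ?D G"
    by (rule derived_is_subgroup) simp
  then interpret D: group "G\<lparr>carrier := ?D\<rparr>"
    by (rule subgroup_imp_group)
  have carrier_D: "carrier (G\<lparr>carrier := ?D\<rparr>) = ?D"
    by simp
  obtain c where c: "c \<in> ?D" "?D = range (\<lambda>i::int. c [^]\<^bsub>G\<lparr>carrier := ?D\<rparr>\<^esub> i)"
    by (rule bexE[OF D.cyclic_group[THEN iffD1, OF cyc, unfolded carrier_D]])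
  have cG: "c \<in> carrier G"
    using D c(1) by (rule subgroup.mem_carrier)
  have ord: "ord c > 0"
    using ord_ge_1[OF fin cG] by simp
  \<comment> \<open>Integer exponents are reduced modulo the finite order of \<open>c\<close> to
    natural ones.\<close>
  have powers: "\<exists>i::nat. x = c [^] i" if x: "x \<in> ?D" for x
  proof -
    obtain i :: int where "x = c [^]\<^bsub>G\<lparr>carrier := ?D\<rparr>\<^esub> i"
      by (rule rangeE[OF equalityD1[OF c(2), THEN subsetD, OF x]])
    then have i: "x = c [^] i"
      by (simp only: int_pow_consistent[OF D c(1)])
    have "c [^] i = c [^] int (nat (i mod int (ord c)))"
      using ord by (simp add: int_pow_eq[OF cG] mod_eq_dvd_iff[symmetric] mod_mod_trivial)
    then show ?thesis
      using i by (metis int_pow_int)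
  qed
  have "cyclic_by_abelian (cayley ` carrier G) (cayley c) (ord c)"
  proof
    show "finite (cayley ` carrier G)"
      using fin by simp
    show "0 \<in> cayley ` carrier G"
      by (rule image_eqI[where x = \<one>]) (simp_all add: cayley_one)
    show "cayley c \<in> cayley ` carrier G"
      using cG by simp
    show "ord c > 0"
      by fact
    fix a b assume a: "a \<in> cayley ` carrier G"
    then obtain g where g: "g \<in> carrier G" "a = cayley g"
      by blast
    show "- a \<in> cayley ` carrier G"
      using g by (simp add: cayley_uminus)
    assume "b \<in> cayley ` carrier G"
    then obtain h where h: "h \<in> carrier G" "b = cayley h"
      by blast
    show "a + b \<in> cayley ` carrier G"
      using g h by (simp flip: cayley_mult)
    \<comment> \<open>The commutator is formed from the inverses so that it ends up to the right of
      \<open>h \<otimes> g\<close>, as the locale requires.\<close>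
    have "inv g \<otimes> inv h \<otimes> inv (inv g) \<otimes> inv (inv h) \<in> ?D"
      unfolding derived_def using g h by (intro generate.incl) blast
    then obtain i :: nat where i: "inv g \<otimes> inv h \<otimes> inv (inv g) \<otimes> inv (inv h) = c [^] i"
      using powers by blast
    have "x \<otimes> (inv x \<otimes> y) = y" if "x \<in> carrier G" "y \<in> carrier G" for x y
      using that by (simp add: m_assoc[symmetric])
    then have "g \<otimes> h = h \<otimes> g \<otimes> c [^] i"
      using g h by (simp add: i[symmetric] m_assoc)
    then have "a + b = b + a + cayley (c [^] i)"
      using g h cG by (simp flip: cayley_mult)
    then show "\<exists>k. frag_of a * frag_of b = frag_of b * frag_of a * frag_of (cayley c) ^ k"
      by (simp only: frag_of_cayley_power[OF cG] frag_of_mult) blast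
  next
    fix i
    have "frag_of (cayley c) ^ i = 1 \<longleftrightarrow> cayley (c [^] i) = cayley \<one>"
      by (simp only: frag_of_cayley_power[OF cG] frag_of_eq_1_iff cayley_one)
    also have "\<dots> \<longleftrightarrow> c [^] i = \<one>"
      using inj_on_cayley cG by (simp add: inj_on_eq_iff)
    also have "\<dots> \<longleftrightarrow> ord c dvd i"
      by (rule pow_eq_id[OF cG])
    finally show "frag_of (cayley c) ^ i = 1 \<longleftrightarrow> ord c dvd i" .
  qed
  then show ?thesis
    by blast
qed

text \<open>Finiteness of \<open>S\<close> makes its elements torsion units, so the map of
  \<open>ex_group_element_map\<close>, pulled back along \<open>cayley\<close>, is an injective
  homomorphism on \<open>S\<close>.\<close>

theorem finite_subgroup_normalized_units_embeds:
  assumes fin: "finite (carrier G)" and cyc: "cyclic_group (G\<lparr>carrier := derived G (carrier G)\<rparr>)"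
    and S: "subgroup S (normalized_units G)" "finite S"
  shows "\<exists>K. subgroup K G \<and> (normalized_units G)\<lparr>carrier := S\<rparr> \<cong> G\<lparr>carrier := K\<rparr>"
proof -
  let ?V = "normalized_units G"
  let ?R = "integral_group_ring G"
  let ?VS = "?V\<lparr>carrier := S\<rparr>"
  interpret R: ring ?R
    by (rule ring_integral_group_ring)
  interpret V: group ?V
    by (rule group_normalized_units)
  interpret VS: group ?VS
    using S(1) by (rule V.subgroup_imp_group)
  obtain c n where "cyclic_by_abelian (cayley ` carrier G) c n"
    using cyclic_by_abelian_cayley[OF fin cyc] by blast
  then interpret cyclic_by_abelian "cayley ` carrier G" c n .
  have carrier: "u \<in> carrier ?R" "augmentation u = 1" if "u \<in> S" for u
    using subgroup.mem_carrier[OF S(1) that] by (auto simp: normalized_units_def R.Units_closed)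
  have mult: "u \<otimes>\<^bsub>?VS\<^esub> v = u \<otimes>\<^bsub>?R\<^esub> v" for u v
    by (simp add: normalized_units_def units_of_def)
  have one: "\<one>\<^bsub>?VS\<^esub> = frag_of \<one>"
    by (simp add: normalized_units_def units_of_def integral_group_ring_simps)
  have cayley_ring_VS: "cayley_ring (u \<otimes>\<^bsub>?VS\<^esub> v) = cayley_ring u * cayley_ring v"
    if "u \<in> S" "v \<in> S" for u v
    using that carrier by (simp only: mult cayley_ring_mult)
  have cayley_ring_one: "cayley_ring \<one>\<^bsub>?VS\<^esub> = 1"
    by (simp only: one cayley_ring_frag_of cayley_one frag_of_zero)
  have pow: "cayley_ring (u [^]\<^bsub>?VS\<^esub> i) = cayley_ring u ^ i" if "u \<in> S" for u and i :: nat
  proof (induction i)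
    case (Suc i)
    have "u [^]\<^bsub>?VS\<^esub> i \<in> S"
      using VS.nat_pow_closed[of u i] that by simp
    then show ?case
      using Suc that by (simp only: VS.nat_pow_Suc cayley_ring_VS power_Suc2)
  qed (simp only: VS.nat_pow_0 cayley_ring_one power_0)
  have torsion: "cayley_ring u \<in> normalized_torsion" if u: "u \<in> S" for u
  proof -
    have "u [^]\<^bsub>?VS\<^esub> card S = \<one>\<^bsub>?VS\<^esub>"
      using VS.pow_order_eq_1[of u] u by (simp add: order_def)
    then have "cayley_ring u ^ card S = 1"
      using pow[OF u] cayley_ring_one by metis
    moreover have "card S > 0"
      using u S(2) by (auto simp: card_gt_0_iff)
    ultimately show ?thesis
      using carrier[OF u] keys_cayley_ring
      by (auto simp: normalized_torsion_def ZH_def augmentation_cayley_ring)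
  qed
  obtain f where "(\<forall>u\<in>normalized_torsion. f u \<in> cayley ` carrier G \<and> (f u = 0 \<longrightarrow> u = 1)) \<and>
    (\<forall>u\<in>normalized_torsion. \<forall>v\<in>normalized_torsion.
      u * v \<in> normalized_torsion \<longrightarrow> f (u * v) = f u + f v)"
    by (rule exE[OF ex_group_element_map])
  then have f: "\<And>u. u \<in> normalized_torsion \<Longrightarrow> f u \<in> cayley ` carrier G"
    "\<And>u. u \<in> normalized_torsion \<Longrightarrow> f u = 0 \<Longrightarrow> u = 1"
    "\<And>u v. u \<in> normalized_torsion \<Longrightarrow> v \<in> normalized_torsion \<Longrightarrow> u * v \<in> normalized_torsion \<Longrightarrow>
      f (u * v) = f u + f v"
    by simp_all
  define \<psi> where "\<psi> = (\<lambda>u. inv_into (carrier G) cayley (f (cayley_ring u)))"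
  have \<psi>: "\<psi> u \<in> carrier G" "cayley (\<psi> u) = f (cayley_ring u)" if "u \<in> S" for u
    using f(1)[OF torsion[OF that]] by (auto simp: \<psi>_def inv_into_into f_inv_into_f)
  have "\<psi> \<in> hom ?VS G"
  proof (rule homI)
    fix u v assume "u \<in> carrier ?VS" "v \<in> carrier ?VS"
    then have u: "u \<in> S" and v: "v \<in> S" and uv: "u \<otimes>\<^bsub>?VS\<^esub> v \<in> S"
      using VS.m_closed[of u v] by simp_all
    have "cayley (\<psi> (u \<otimes>\<^bsub>?VS\<^esub> v)) = cayley (\<psi> u \<otimes> \<psi> v)"
      using f(3)[OF torsion[OF u] torsion[OF v]] torsion[OF uv]
      by (simp only: \<psi> u v uv cayley_mult cayley_ring_VS)
    then show "\<psi> (u \<otimes>\<^bsub>?VS\<^esub> v) = \<psi> u \<otimes> \<psi> v"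
      using inj_on_cayley \<psi>(1) u v uv by (simp only: inj_on_eq_iff m_closed)
  qed (use \<psi> in simp)
  then interpret \<psi>: group_hom ?VS G \<psi>
    by unfold_locales
  have "inj_on \<psi> (carrier ?VS)"
    unfolding \<psi>.inj_on_one_iff
  proof (intro allI impI)
    fix u assume "u \<in> carrier ?VS" and 1: "\<psi> u = \<one>"
    then have u: "u \<in> S"
      by simp
    have "cayley_ring u = cayley_ring \<one>\<^bsub>?VS\<^esub>"
      unfolding cayley_ring_one using f(2)[OF torsion[OF u]] \<psi>(2)[OF u] by (simp only: 1 cayley_one)
    moreover have "\<one>\<^bsub>?VS\<^esub> \<in> S"
      using VS.one_closed by simp
    ultimately show "u = \<one>\<^bsub>?VS\<^esub>"
      using inj_on_cayley_ring carrier u by (meson inj_on_eq_iff)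
  qed
  then have "\<psi> \<in> iso ?VS (G\<lparr>carrier := \<psi> ` S\<rparr>)"
    using \<psi>.homh by (auto simp: iso_def hom_def bij_betw_def)
  moreover have "subgroup (\<psi> ` S) G"
    using \<psi>.img_is_subgroup by simp
  ultimately show ?thesis
    by (auto simp: is_iso_def)
qed

end

theorem theorem5:
  fixes G :: "('a, 'b) monoid_scheme"
    and T :: "('t, 'c) monoid_scheme"
    and p q h k :: nat
    and \<phi> :: "int \<Rightarrow> int \<Rightarrow> int"
  assumes "group G" and "finite (carrier G)"
    and "cyclic_group (G\<lparr>carrier := derived G (carrier G)\<rparr>)"
    and "Factorial_Ring.prime p" and "Factorial_Ring.prime q" and "p \<noteq> q" and "h > 0" and "k > 0"
    and "\<phi> \<in> hom (integer_mod_group (q ^ k)) (AutoGroup (integer_mod_group (p ^ h)))"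
    and "group T"
    and "T \<cong> semidirect_product (integer_mod_group (p ^ h)) (integer_mod_group (q ^ k)) \<phi>"
    and "\<exists>S. subgroup S (normalized_units G) \<and> (normalized_units G)\<lparr>carrier := S\<rparr> \<cong> T"
  shows "\<exists>S. subgroup S G \<and> G\<lparr>carrier := S\<rparr> \<cong> T"
proof -
  interpret group G by fact
  obtain S where S: "subgroup S (normalized_units G)" "(normalized_units G)\<lparr>carrier := S\<rparr> \<cong> T"
    using assms by blast
  \<comment> \<open>Positive moduli are needed for finiteness: \<open>integer_mod_group 0\<close> is
    the infinite cyclic group.\<close>
  have "p > 0" "q > 0"
    using assms by (auto simp: prime_gt_0_nat)
  then have "finite (carrier T)"
    using iso_finite[OF assms(11)] by (simp add: semidirect_product_def carrier_integer_mod_group)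
  then have "finite S"
    using iso_finite[OF S(2)] by simp
  then obtain K where K: "subgroup K G" "(normalized_units G)\<lparr>carrier := S\<rparr> \<cong> G\<lparr>carrier := K\<rparr>"
    using finite_subgroup_normalized_units_embeds[OF assms(2,3) S(1)] by blast
  have "group ((normalized_units G)\<lparr>carrier := S\<rparr>)"
    using group.subgroup_imp_group[OF group_normalized_units S(1)] .
  then have "G\<lparr>carrier := K\<rparr> \<cong> (normalized_units G)\<lparr>carrier := S\<rparr>"
    using K(2) by (rule group.iso_sym)
  then show ?thesis
    using K(1) S(2) iso_trans by blast
qed

end
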